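(* Let $A$ be a $C^*$-algebra (not necessarily unital or commutative) and let $E$ be a Hilbert $C^*$-module over $A$, with $A$-valued inner product $\langle\cdot,\cdot\rangle$ and norm $\|x\|=\|\langle x,x\rangle\|^{1/2}$. Then the Banach space $E$, equipped with the triple product $$\{x,y,z\}:=\tfrac12\big(x.\langle y,z\rangle+z.\langle y,x\rangle\big),\qquad x,y,z\in E,$$ is a JB$^*$-triple.
   Context: Let $A$ be a $C^*$-algebra. An inner product $A$-module is a complex vector space $E$ with maps $E\times A\to E$, $(x,a)\mapsto x.a$, and $E\times E\to A$, $(x,y)\mapsto\langle x,y\rangle$, such that: $E$ is a right $A$-module with $\lambda(x.a)=(\lambda x).a=x.(\lambda a)$ for $\lambda\in\mathbb{C}$, $x\in E$, $a\in A$; and for all $x,y,z\in E$, $\alpha,\beta\in\mathbb{C}$, $a\in A$: $\langle x,\alpha y+\beta z\rangle=\alpha\langle x,y\rangle+\beta\langle x,z\rangle$; $\langle x,y.a\rangle=\langle x,y\rangle a$; $\langle y,x\rangle=\langle x,y\rangle^*$; $\langle x,x\rangle\ge 0$, and $\langle x,x\rangle=0$ implies $x=0$. (So the inner product is linear in the second variable and conjugate linear in the first.) Then $\|x\|:=\|\langle x,x\rangle\|_A^{1/2}$ is a norm on $E$; $E$ is called a Hilbert $C^*$-module over $A$ if it is complete in this norm. A JB$^*$-triple is a complex Banach space $Z$ with a continuous map $(a,b,c)\mapsto\{a,b,c\}$ from $Z\times Z\times Z$ to $Z$ such that, writing $a\square b\in\mathcal{L}(Z)$ for the bounded operator $z\mapsto\{a,b,z\}$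 and $[\cdot,\cdot]$ for the commutator of operators, the following hold for all $a,b,c,d\in Z$: (1) $\{a,b,c\}$ is symmetric and complex linear in $a,c$ and conjugate linear in $b$; (2) $[a\square b,c\square d]=\{a,b,c\}\square d-c\square\{d,a,b\}$; (3) $a\square a$ is hermitian (i.e. $\exp(it\,a\square a)$ is an isometry of $Z$ for every $t\in\mathbb{R}$) and has spectrum contained in $[0,\infty)$; (4) $\|\{a,a,a\}\|=\|a\|^3$. Here $\mathcal{L}(Z)$ is the Banach algebra of bounded complex-linear operators on $Z$. *)

theory Defs
  imports "HOL-Analysis.Analysis"
begin

text \<open>
  The sort \<open>{real_normed_algebra, banach}\<close> provides a real Banach algebra, not necessarily unital
  or commutative; the complex structure and the involution are parameters.
\<close>

locale c_star_algebra = vector_space scaleC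
  for scaleC :: "complex \<Rightarrow> 'a \<Rightarrow> 'a::{real_normed_algebra,banach}" +
  fixes star :: "'a \<Rightarrow> 'a"
  assumes scaleC_of_real: "scaleC (of_real r) a = r *\<^sub>R a"
    and scaleC_mult_left: "scaleC \<alpha> a * b = scaleC \<alpha> (a * b)"
    and scaleC_mult_right: "a * scaleC \<alpha> b = scaleC \<alpha> (a * b)"
    and norm_scaleC: "norm (scaleC \<alpha> a) = cmod \<alpha> * norm a"
    and star_add: "star (a + b) = star a + star b"
    and star_scaleC: "star (scaleC \<alpha> a) = scaleC (cnj \<alpha>) (star a)"
    and star_mult: "star (a * b) = star b * star a"
    and star_star: "star (star a) = a"
    and c_star_identity: "norm (star a * a) = (norm a)\<^sup>2"
begin

text \<open>
  Since the algebra need not have a unit, spectra are computed in the unitization, i.e. in the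
  algebra of formal sums \<open>a + \<alpha> 1\<close>, represented as pairs \<open>(a, \<alpha>)\<close>. If the algebra
  already has a unit, this adds at most the point 0 to the usual spectrum, which does not
  affect positivity.
\<close>

definition unitization_mult :: "'a \<times> complex \<Rightarrow> 'a \<times> complex \<Rightarrow> 'a \<times> complex" where
  "unitization_mult = (\<lambda>(a, \<alpha>) (b, \<beta>). (a * b + scaleC \<beta> a + scaleC \<alpha> b, \<alpha> * \<beta>))"

definition spectrum :: "'a \<Rightarrow> complex set" where
  "spectrum a = {\<mu>. \<not> (\<exists>u. unitization_mult (a, - \<mu>) u = (0, 1)
                        \<and> unitization_mult u (a, - \<mu>) = (0, 1))}"

definition positive :: "'a \<Rightarrow> bool" where
  "positive a \<longleftrightarrow> star a = a \<and> spectrum a \<subseteq> \<real>\<^sub>\<ge>\<^sub>0"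

end

locale inner_product_module =
  A: c_star_algebra scaleA star + E: vector_space scaleE
  for scaleA :: "complex \<Rightarrow> 'a \<Rightarrow> 'a::{real_normed_algebra,banach}"
    and star :: "'a \<Rightarrow> 'a"
    and scaleE :: "complex \<Rightarrow> 'e \<Rightarrow> 'e::ab_group_add" +
  fixes act :: "'e \<Rightarrow> 'a \<Rightarrow> 'e"
    and ip :: "'e \<Rightarrow> 'e \<Rightarrow> 'a"
  assumes act_add_left: "act (x + y) a = act x a + act y a"
    and act_add_right: "act x (a + b) = act x a + act x b"
    and act_mult: "act x (a * b) = act (act x a) b"
    and scaleE_act_left: "scaleE \<alpha> (act x a) = act (scaleE \<alpha> x) a"
    and scaleE_act_right: "scaleE \<alpha> (act x a) = act x (scaleA \<alpha> a)"
    and inner_linear: "ip x (scaleE \<alpha> y + scaleE \<beta> z) = scaleA \<alpha> (ip x y) + scaleA \<beta> (ip x z)"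
    and inner_act: "ip x (act y a) = ip x y * a"
    and inner_star: "ip y x = star (ip x y)"
    and inner_positive: "A.positive (ip x x)"
    and inner_definite: "ip x x = 0 \<Longrightarrow> x = 0"

definition module_norm :: "('e \<Rightarrow> 'e \<Rightarrow> 'a::real_normed_vector) \<Rightarrow> 'e \<Rightarrow> real" where
  "module_norm ip x = sqrt (norm (ip x x))"

locale hilbert_c_star_module = inner_product_module scaleA star scaleE act ip
  for scaleA :: "complex \<Rightarrow> 'a \<Rightarrow> 'a::{real_normed_algebra,banach}"
    and star :: "'a \<Rightarrow> 'a"
    and scaleE :: "complex \<Rightarrow> 'e \<Rightarrow> 'e::ab_group_add"
    and act :: "'e \<Rightarrow> 'a \<Rightarrow> 'e"
    and ip :: "'e \<Rightarrow> 'e \<Rightarrow> 'a" +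
  assumes complete: "Metric_space.mcomplete UNIV (\<lambda>x y. module_norm ip (x - y))"

text \<open>
  The norm of the module is derived from the inner product, so normed spaces are described here
  by an explicit norm function rather than by the class \<open>real_normed_vector\<close>.
\<close>

locale complex_normed_space = vector_space scale
  for scale :: "complex \<Rightarrow> 'z \<Rightarrow> 'z::ab_group_add" +
  fixes nrm :: "'z \<Rightarrow> real"
  assumes nrm_eq_0: "nrm x = 0 \<longleftrightarrow> x = 0"
    and nrm_triangle: "nrm (x + y) \<le> nrm x + nrm y"
    and nrm_scale: "nrm (scale \<alpha> x) = cmod \<alpha> * nrm x"
begin

lemma nrm_minus: "nrm (- x) = nrm x"
  using nrm_scale[of "- 1" x] by simp

lemma nrm_nonneg: "0 \<le> nrm x"
  using nrm_triangle[of x "- x"] nrm_eq_0[of 0] nrm_minus[of x] by simp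

sublocale metric: Metric_space UNIV "\<lambda>x y. nrm (x - y)"
proof
  show "nrm (x - y) = nrm (y - x)" for x y
    using nrm_minus[of "x - y"] by simp
  show "nrm (x - z) \<le> nrm (x - y) + nrm (y - z)" for x y z
    using nrm_triangle[of "x - y" "y - z"] by simp
qed (simp_all add: nrm_nonneg nrm_eq_0)

end

locale complex_banach_space = complex_normed_space scale nrm
  for scale :: "complex \<Rightarrow> 'z \<Rightarrow> 'z::ab_group_add"
    and nrm :: "'z \<Rightarrow> real" +
  assumes complete: "metric.mcomplete"
begin

definition bounded_op :: "('z \<Rightarrow> 'z) \<Rightarrow> bool" where
  "bounded_op T \<longleftrightarrow> Vector_Spaces.linear scale scale T \<and> (\<exists>K. \<forall>z. nrm (T z) \<le> K * nrm z)"

definition op_norm :: "('z \<Rightarrow> 'z) \<Rightarrow> real" where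
  "op_norm T = (SUP z\<in>{z. nrm z \<le> 1}. nrm (T z))"

text \<open>The sum of the exponential series, with convergence in the operator norm.\<close>

definition op_exp :: "('z \<Rightarrow> 'z) \<Rightarrow> 'z \<Rightarrow> 'z" where
  "op_exp T = (THE U. bounded_op U \<and>
     (\<lambda>n. op_norm (\<lambda>z. U z - (\<Sum>k<n. scale (1 / fact k) ((T ^^ k) z)))) \<longlonglongrightarrow> 0)"

definition hermitian_op :: "('z \<Rightarrow> 'z) \<Rightarrow> bool" where
  "hermitian_op T \<longleftrightarrow>
     (\<forall>t::real. \<forall>z. nrm (op_exp (\<lambda>w. scale (\<i> * of_real t) (T w)) z) = nrm z)"

definition op_spectrum :: "('z \<Rightarrow> 'z) \<Rightarrow> complex set" where
  "op_spectrum T = {\<mu>. \<not> (\<exists>S. bounded_op S \<and>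
     (\<forall>z. S (T z - scale \<mu> z) = z) \<and> (\<forall>z. T (S z) - scale \<mu> (S z) = z))}"

end

text \<open>The operator \<open>a \<box> b\<close> is the partial application \<open>triple a b\<close>.\<close>

locale jb_star_triple = complex_banach_space scale nrm
  for scale :: "complex \<Rightarrow> 'z \<Rightarrow> 'z::ab_group_add"
    and nrm :: "'z \<Rightarrow> real" +
  fixes triple :: "'z \<Rightarrow> 'z \<Rightarrow> 'z \<Rightarrow> 'z"
  assumes triple_continuous:
      "continuous_map
         (prod_topology metric.mtopology (prod_topology metric.mtopology metric.mtopology))
         metric.mtopology (\<lambda>(a, b, c). triple a b c)"
    and triple_symmetric: "triple a b c = triple c b a"
    and triple_linear_left: "Vector_Spaces.linear scale scale (\<lambda>a. triple a b c)"
    and triple_linear_right: "Vector_Spaces.linear scale scale (\<lambda>c. triple a b c)"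
    and triple_add_middle: "triple a (b + b') c = triple a b c + triple a b' c"
    and triple_scale_middle: "triple a (scale \<alpha> b) c = scale (cnj \<alpha>) (triple a b c)"
    and jordan_identity:
      "triple a b (triple c d z) - triple c d (triple a b z)
         = triple (triple a b c) d z - triple c (triple d a b) z"
    and box_hermitian: "hermitian_op (triple a a)"
    and box_spectrum: "op_spectrum (triple a a) \<subseteq> \<real>\<^sub>\<ge>\<^sub>0"
    and nrm_triple: "nrm (triple a a a) = nrm a ^ 3"

end

theory Submission
  imports Defs
begin

text \<open>
  Write \<open>h = \<langle>a, a\<rangle>\<close>, \<open>\<theta> z = a.\<langle>a, z\<rangle>\<close> and \<open>R z = z.h\<close>, so that \<open>a \<box> a = (\<theta> + R) / 2\<close>. The Jordan identity is a
  formal computation with the module axioms, and \<open>\<parallel>{a, a, a}\<parallel> = \<parallel>a\<parallel>\<^sup>3\<close> says that \<open>\<parallel>h\<^sup>3\<parallel> = \<parallel>h\<parallel>\<^sup>3\<close> for the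
  self-adjoint \<open>h\<close>. What remains is to show that the module norm is a norm with the Cauchy-Schwarz
  inequality, and that \<open>a \<box> a\<close> is hermitian with nonnegative spectrum.

  For a bounded operator \<open>K\<close> the latter follows from two metric estimates, which are both convex in
  \<open>K\<close> and so may be checked for \<open>\<theta>\<close> and \<open>R\<close> separately: \<open>\<parallel>(1 + i s K) z\<parallel> \<le> (1 + C s\<^sup>2) \<parallel>z\<parallel>\<close> for all
  real \<open>s\<close>, and \<open>\<parallel>(t - K) z\<parallel> \<le> t \<parallel>z\<parallel>\<close> for one \<open>t > 0\<close>. Given the first, the function \<open>\<parallel>exp (i t K) z\<parallel>\<close> of
  \<open>t\<close> has increments of second order and is therefore constant (\<open>hermitian_op_if_imaginary_step\<close>);
  given both, a Neumann series inverts \<open>K - \<mu>\<close> for every \<open>\<mu>\<close> outside \<open>[0, \<infinity>)\<close> (\<open>op_spectrum_nonneg\<close>).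

  The first estimate comes from expanding a square. The second is where positivity enters, and
  positivity is given only as a condition on spectra. The bridge from spectra to norms is
  \<open>symmetric_nrm_le_of_real_points\<close>: one of \<open>\<parallel>K\<parallel>\<close> and \<open>- \<parallel>K\<parallel>\<close> is an approximate eigenvalue of a symmetric
  operator \<open>K\<close>. It replaces the spectral radius formula and is proved by extracting one coefficient
  from the square of a geometric sum (\<open>resolvent_power_bound\<close>). Consequently a positive \<open>h\<close> satisfies
  \<open>\<parallel>t x - h x\<parallel> \<le> t \<parallel>x\<parallel>\<close> for \<open>t \<ge> \<parallel>h\<parallel>\<close>, which gives the estimate for \<open>R\<close>; and \<open>\<theta>\<close> has no negative
  approximate eigenvalues because \<open>h\<close> has none and \<open>\<langle>a, \<theta> z\<rangle> = h \<langle>a, z\<rangle>\<close>.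

  The same principle shows that \<open>\<parallel>k\<parallel> \<le> \<parallel>b\<parallel>\<close> whenever \<open>b + k\<close> and \<open>b - k\<close> are positive and \<open>k\<close> is
  self-adjoint. Applied to the inner squares of \<open>\<beta> x + \<alpha> y\<close> and \<open>\<beta> x - \<alpha> y\<close>, where \<open>\<alpha> = \<parallel>x\<parallel>\<close> and
  \<open>\<beta> = \<parallel>y\<parallel>\<close>, this yields \<open>\<parallel>\<langle>x, y\<rangle> + \<langle>y, x\<rangle>\<parallel> \<le> 2 \<parallel>x\<parallel> \<parallel>y\<parallel>\<close>. That is the triangle inequality, and
  with \<open>x\<close> replaced by \<open>x.\<langle>x, y\<rangle>\<close> it becomes the Cauchy-Schwarz inequality.
\<close>

section \<open>Geometric sums of operators and lower bounds on the unit circle\<close>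

context complex_normed_space
begin

lemma linear_diff: "Vector_Spaces.linear scale scale T \<Longrightarrow> T (x - y) = T x - T y"
  by (rule module_hom.diff[of scale scale]) (simp add: module_hom_iff_linear)

lemma linear_sum: "Vector_Spaces.linear scale scale T \<Longrightarrow> T (sum f S) = (\<Sum>i\<in>S. T (f i))"
  by (rule module_hom.sum[of scale scale]) (simp add: module_hom_iff_linear)

lemma linear_scale: "Vector_Spaces.linear scale scale T \<Longrightarrow> T (scale c x) = scale c (T x)"
  by (rule module_hom.scale[of scale scale]) (simp add: module_hom_iff_linear)

lemma linearI:
  "(\<And>x y. T (x + y) = T x + T y) \<Longrightarrow> (\<And>c x. T (scale c x) = scale c (T x))
    \<Longrightarrow> Vector_Spaces.linear scale scale T"
  by (simp add: Vector_Spaces.linear_iff vector_space_axioms)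

lemma linear_funpow:
  "Vector_Spaces.linear scale scale T \<Longrightarrow> Vector_Spaces.linear scale scale (T ^^ n)"
  by (induction n) (auto simp: Vector_Spaces.linear_iff vector_space_axioms)

lemma nrm_0 [simp]: "nrm 0 = 0"
  by (simp add: nrm_eq_0)

lemma nrm_triangle_diff: "nrm (x - y) \<le> nrm x + nrm y"
  using nrm_triangle[of x "- y"] nrm_minus[of y] by simp

lemma nrm_reverse_triangle: "nrm x - nrm y \<le> nrm (x - y)"
  using nrm_triangle[of "x - y" y] by simp

lemma nrm_sum: "nrm (sum f S) \<le> (\<Sum>i\<in>S. nrm (f i))"
proof (induction S rule: infinite_finite_induct)
  case (insert i S)
  then show ?case
    using nrm_triangle[of "f i" "sum f S"] by simp
qed auto

lemma nrm_funpow_le: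
  assumes "\<And>x. nrm (T x) \<le> M * nrm x" "0 \<le> M"
  shows "nrm ((T ^^ n) x) \<le> M ^ n * nrm x"
proof (induction n)
  case (Suc n)
  have "nrm ((T ^^ Suc n) x) \<le> M * nrm ((T ^^ n) x)"
    using assms(1) by simp
  also have "\<dots> \<le> M * (M ^ n * nrm x)"
    by (intro mult_left_mono Suc assms)
  finally show ?case by (simp add: mult.assoc)
qed simp

end

lemma sum_root_of_unity_powers:
  fixes N m :: nat
  assumes "0 < N"
  shows "(\<Sum>j<N. exp (2 * of_real pi * \<i> * of_nat j / of_nat N) ^ m)
           = (if N dvd m then of_nat N else (0::complex))"
proof -
  define \<omega> where "\<omega> = exp (2 * of_real pi * \<i> * of_nat m / of_nat N)"
  have pow: "exp (2 * of_real pi * \<i> * of_nat j / of_nat N) ^ m = \<omega> ^ j" for j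
    unfolding \<omega>_def exp_of_nat_mult[symmetric] by (simp add: mult_ac)
  have root: "\<omega> ^ N = 1"
    unfolding \<omega>_def using complex_root_unity[of N m] assms by simp
  have one: "\<omega> = 1 \<longleftrightarrow> N dvd m"
    unfolding \<omega>_def using complex_root_unity_eq_1[of N m] assms by simp
  show ?thesis
  proof (cases "\<omega> = 1")
    case True
    then show ?thesis by (simp add: pow one[symmetric])
  next
    case False
    then show ?thesis
      using one geometric_sum[of \<omega> N] root by (simp add: pow)
  qed
qed

context complex_normed_space
begin

lemma geometric_sum_telescope:
  assumes "Vector_Spaces.linear scale scale k"
  shows "(\<Sum>l<n. scale (w ^ l) ((k ^^ l) x)) - scale w (k (\<Sum>l<n. scale (w ^ l) ((k ^^ l) x)))
           = x - scale (w ^ n) ((k ^^ n) x)"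
proof (induction n)
  case 0
  then show ?case using linear_sum[OF assms, of "\<lambda>_. 0" "{}"] by simp
next
  case (Suc n)
  let ?G = "\<Sum>l<n. scale (w ^ l) ((k ^^ l) x)" and ?t = "scale (w ^ n) ((k ^^ n) x)"
  have "k (?G + ?t) = k ?G + scale (w ^ n) ((k ^^ Suc n) x)"
    using assms by (simp add: Vector_Spaces.linear_iff)
  then have "(?G + ?t) - scale w (k (?G + ?t))
      = (?G - scale w (k ?G)) + ?t - scale (w ^ Suc n) ((k ^^ Suc n) x)"
    by (simp add: scale_right_distrib)
  with Suc show ?case by simp
qed

text \<open>
  If \<open>1 - \<omega> k\<close> is bounded below on the unit circle, then the geometric sums
  \<open>G \<omega> = (\<Sum>l\<le>n. \<omega>\<^sup>l k\<^sup>l)\<close> are bounded there independently of \<open>n\<close>, since \<open>(1 - \<omega> k) (G \<omega>)\<close>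
  telescopes to a difference of two contractions. The coefficient of \<open>\<omega>\<^sup>n\<close> in \<open>(G \<omega>)\<^sup>2\<close> is
  \<open>(n + 1) k\<^sup>n\<close>, and averaging over roots of unity shows that it obeys the bound for \<open>(G \<omega>)\<^sup>2\<close>. So
  \<open>k\<^sup>n\<close> tends to 0. This takes the place of the spectral radius formula, whose usual proof needs
  vector-valued complex analysis.
\<close>

lemma resolvent_power_bound:
  assumes lin: "Vector_Spaces.linear scale scale k"
    and contr: "\<And>x. nrm (k x) \<le> nrm x"
    and "0 < \<delta>"
    and below: "\<And>\<omega> x. cmod \<omega> = 1 \<Longrightarrow> \<delta> * nrm x \<le> nrm (x - scale \<omega> (k x))"
  shows "real (Suc n) * nrm ((k ^^ n) x) \<le> 4 / \<delta>\<^sup>2 * nrm x"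
proof -
  define G where "G = (\<lambda>w x. \<Sum>l<Suc n. scale (w ^ l) ((k ^^ l) x))"
  have G_bound: "nrm (G w x) \<le> 2 / \<delta> * nrm x" if w: "cmod w = 1" for w x
  proof -
    have "nrm ((k ^^ Suc n) x) \<le> nrm x"
      using nrm_funpow_le[where T = k and M = 1 and n = "Suc n" and x = x] contr by simp
    then have "nrm (x - scale (w ^ Suc n) ((k ^^ Suc n) x)) \<le> 2 * nrm x"
      using nrm_triangle_diff[of x "scale (w ^ Suc n) ((k ^^ Suc n) x)"] w
      by (simp add: nrm_scale norm_power norm_mult)
    then have "\<delta> * nrm (G w x) \<le> 2 * nrm x"
      using below[OF w, of "G w x"] geometric_sum_telescope[OF lin, where w = w and n = "Suc n" and x = x]
      unfolding G_def by simp
    then show ?thesis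
      using \<open>0 < \<delta>\<close> by (simp add: field_simps)
  qed
  have GG_bound: "nrm (G w (G w x)) \<le> 4 / \<delta>\<^sup>2 * nrm x" if w: "cmod w = 1" for w
  proof -
    have "nrm (G w (G w x)) \<le> 2 / \<delta> * (2 / \<delta> * nrm x)"
      using G_bound[OF w, of "G w x"] mult_left_mono[OF G_bound[OF w, of x], of "2 / \<delta>"] \<open>0 < \<delta>\<close>
      by simp
    then show ?thesis by (simp add: power2_eq_square)
  qed
  define N where "N = 2 * Suc n"
  define \<zeta> where "\<zeta> = (\<lambda>j. exp (2 * of_real pi * \<i> * of_nat j / of_nat N) :: complex)"
  have \<zeta>: "cmod (\<zeta> j) = 1" for j
  proof -
    have "\<zeta> j = exp (\<i> * of_real (2 * pi * real j / real N))"
      unfolding \<zeta>_def by (simp add: field_simps)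
    then show ?thesis by (simp only: norm_exp_i_times)
  qed
  \<comment> \<open>As \<open>\<zeta> j\<close> is an \<open>N\<close>-th root of unity, the exponent \<open>n + 2\<close> stands for \<open>- n\<close>.\<close>
  have GG: "scale (w ^ (n + 2)) (G w (G w x))
      = (\<Sum>a<Suc n. \<Sum>b<Suc n. scale (w ^ (n + 2 + a + b)) ((k ^^ (a + b)) x))" for w
  proof -
    have "(k ^^ a) (G w x) = (\<Sum>b<Suc n. scale (w ^ b) ((k ^^ (a + b)) x))" for a
      unfolding G_def
      by (subst linear_sum[OF linear_funpow[OF lin]], subst linear_scale[OF linear_funpow[OF lin]])
         (simp only: funpow_add o_apply)
    then have "G w (G w x) = (\<Sum>a<Suc n. scale (w ^ a) (\<Sum>b<Suc n. scale (w ^ b) ((k ^^ (a + b)) x)))"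
      by (simp only: G_def)
    then show ?thesis
      by (simp only: scale_sum_right scale_scale power_add mult_ac)
  qed
  have coeff: "(\<Sum>j<N. \<zeta> j ^ (n + 2 + a + b)) = (if a + b = n then of_nat N else 0)"
    if "a < Suc n" "b < Suc n" for a b
  proof -
    have "N dvd n + 2 + a + b \<longleftrightarrow> a + b = n"
    proof
      assume "N dvd n + 2 + a + b"
      then obtain q where q: "n + 2 + a + b = N * q" ..
      have "n + 2 + a + b < N * 2" "0 < n + 2 + a + b"
        using that by (auto simp: N_def)
      then have "N * q < N * 2" "0 < N * q"
        unfolding q by auto
      then have "q = 1" by simp
      with q show "a + b = n" by (simp add: N_def)
    next
      assume "a + b = n"
      then have "n + 2 + a + b = N" by (simp add: N_def)
      then show "N dvd n + 2 + a + b" by simp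
    qed
    then show ?thesis
      unfolding \<zeta>_def using sum_root_of_unity_powers[of N "n + 2 + a + b"] by (simp add: N_def)
  qed
  have "(\<Sum>j<N. scale (\<zeta> j ^ (n + 2)) (G (\<zeta> j) (G (\<zeta> j) x)))
      = (\<Sum>a<Suc n. \<Sum>b<Suc n. scale (\<Sum>j<N. \<zeta> j ^ (n + 2 + a + b)) ((k ^^ (a + b)) x))"
    unfolding GG scale_sum_left
    by (subst sum.swap, rule sum.cong[OF refl], subst sum.swap, rule refl)
  also have "\<dots> = (\<Sum>a<Suc n. \<Sum>b<Suc n. if b = n - a then scale (of_nat N) ((k ^^ n) x) else 0)"
  proof (intro sum.cong refl)
    fix a b assume "a \<in> {..<Suc n}" "b \<in> {..<Suc n}"
    then show "scale (\<Sum>j<N. \<zeta> j ^ (n + 2 + a + b)) ((k ^^ (a + b)) x)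
        = (if b = n - a then scale (of_nat N) ((k ^^ n) x) else 0)"
      by (subst coeff) auto
  qed
  also have "\<dots> = (\<Sum>a<Suc n. scale (of_nat N) ((k ^^ n) x))"
    by (intro sum.cong refl, subst sum.delta) auto
  also have "\<dots> = scale (of_nat (Suc n)) (scale (of_nat N) ((k ^^ n) x))"
    by (subst sum_constant_scale) simp
  finally have eq: "(\<Sum>j<N. scale (\<zeta> j ^ (n + 2)) (G (\<zeta> j) (G (\<zeta> j) x)))
      = scale (of_nat (Suc n)) (scale (of_nat N) ((k ^^ n) x))" .
  have "real (Suc n) * (real N * nrm ((k ^^ n) x)) = nrm (scale (of_nat (Suc n)) (scale (of_nat N) ((k ^^ n) x)))"
    by (simp only: nrm_scale norm_of_nat)
  also have "\<dots> \<le> (\<Sum>j<N. nrm (scale (\<zeta> j ^ (n + 2)) (G (\<zeta> j) (G (\<zeta> j) x))))"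
    unfolding eq[symmetric] by (rule nrm_sum)
  also have "\<dots> \<le> (\<Sum>j<N. 4 / \<delta>\<^sup>2 * nrm x)"
  proof (intro sum_mono)
    fix j
    have "cmod (\<zeta> j ^ (n + 2)) = 1" by (simp only: norm_power \<zeta> power_one)
    then show "nrm (scale (\<zeta> j ^ (n + 2)) (G (\<zeta> j) (G (\<zeta> j) x))) \<le> 4 / \<delta>\<^sup>2 * nrm x"
      using GG_bound[OF \<zeta>[of j]] by (simp only: nrm_scale mult_1)
  qed
  also have "\<dots> = real N * (4 / \<delta>\<^sup>2 * nrm x)"
    by simp
  finally have "real N * (real (Suc n) * nrm ((k ^^ n) x)) \<le> real N * (4 / \<delta>\<^sup>2 * nrm x)"
    by (simp only: mult_ac)
  then show ?thesis
    by (rule mult_left_le_imp_le) (simp add: N_def)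
qed

end

section \<open>Symmetric operators with respect to a form with values in a \<open>C\<^sup>*\<close>-algebra\<close>

context c_star_algebra
begin

lemma star_0 [simp]: "star 0 = 0"
  using star_add[of 0 0] by simp

lemma star_minus: "star (- a) = - star a"
  using star_add[of a "- a"] by (simp add: eq_neg_iff_add_eq_0 add.commute)

lemma star_diff: "star (a - b) = star a - star b"
  using star_add[of a "- b"] by (simp add: star_minus)

lemma norm_star [simp]: "norm (star a) = norm a"
proof -
  have le: "norm b \<le> norm (star b)" for b
  proof (cases "b = 0")
    case False
    have "norm b * norm b \<le> norm (star b) * norm b"
      using norm_mult_ineq[of "star b" b] c_star_identity[of b] by (simp add: power2_eq_square)
    with False show ?thesis by simp
  qed simp
  show ?thesis
    using le[of a] le[of "star a"] by (simp add: star_star)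
qed

lemma norm_star_mult_le: "norm (star a * b) \<le> norm a * norm b"
  using norm_mult_ineq[of "star a" b] by simp

lemma complex_normed_space: "complex_normed_space scaleC norm"
  by unfold_locales (auto simp: norm_scaleC norm_triangle_ineq)

text \<open>
  The element \<open>p - i r c\<close> has imaginary part \<open>- r c\<close>, and taking imaginary parts does not increase
  the norm because the involution is isometric.
\<close>

lemma norm_imaginary_part_le:
  assumes "star p = p" "star c = c"
  shows "\<bar>r\<bar> * norm c \<le> norm (p - scaleC (\<i> * of_real r) c)"
proof -
  let ?z = "p - scaleC (\<i> * of_real r) c"
  have "star ?z - ?z = scaleC (2 * \<i> * of_real r) c"
    using assms scale_left_distrib[of "\<i> * of_real r" "\<i> * of_real r" c]
    by (simp add: star_diff star_scaleC mult.assoc)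
  then have "2 * \<bar>r\<bar> * norm c = norm (star ?z - ?z)"
    by (simp add: norm_scaleC norm_mult)
  also have "\<dots> \<le> 2 * norm ?z"
    using norm_triangle_ineq4[of "star ?z" ?z] by simp
  finally show ?thesis by simp
qed

end

text \<open>
  The setting shared by a \<open>C\<^sup>*\<close>-algebra, with the form \<open>x\<^sup>* y\<close>, and by a Hilbert module over it.
  The Cauchy-Schwarz inequality is an axiom here instead of a consequence of positivity: for the
  algebra it is submultiplicativity of the norm, and the module inherits it from norm estimates on
  the algebra that are themselves obtained in this setting.
\<close>

locale c_star_form =
  A: c_star_algebra scaleA star + complex_normed_space scale nrm
  for scaleA :: "complex \<Rightarrow> 'a \<Rightarrow> 'a::{real_normed_algebra,banach}"
    and star :: "'a \<Rightarrow> 'a"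
    and scale :: "complex \<Rightarrow> 'z \<Rightarrow> 'z::ab_group_add"
    and nrm :: "'z \<Rightarrow> real" +
  fixes form :: "'z \<Rightarrow> 'z \<Rightarrow> 'a"
  assumes form_add_right: "form x (y + z) = form x y + form x z"
    and form_scale_right: "form x (scale \<alpha> y) = scaleA \<alpha> (form x y)"
    and form_star: "form y x = star (form x y)"
    and form_norm: "norm (form x x) = (nrm x)\<^sup>2"
    and form_cauchy_schwarz: "norm (form x y) \<le> nrm x * nrm y"
begin

definition symmetric :: "('z \<Rightarrow> 'z) \<Rightarrow> bool" where
  "symmetric K \<longleftrightarrow> Vector_Spaces.linear scale scale K \<and> (\<forall>x y. form (K x) y = form x (K y))"

lemma form_add_left: "form (x + y) z = form x z + form y z"
  by (metis form_star form_add_right A.star_add)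

lemma form_scale_left: "form (scale \<alpha> x) z = scaleA (cnj \<alpha>) (form x z)"
  by (metis form_star form_scale_right A.star_scaleC)

lemma form_diff_right: "form x (y - z) = form x y - form x z"
  using form_add_right[of x "y - z" z] by simp

lemma form_diff_left: "form (y - z) x = form y x - form z x"
  using form_add_left[of "y - z" z x] by simp

lemma symmetric_funpow: "symmetric K \<Longrightarrow> symmetric (K ^^ n)"
proof (induction n)
  case 0
  then show ?case by (simp add: symmetric_def Vector_Spaces.linear_iff vector_space_axioms)
next
  case (Suc n)
  then have "form ((K ^^ Suc n) x) y = form x ((K ^^ Suc n) y)" for x y
    unfolding symmetric_def funpow_Suc_right by (simp add: funpow_swap1)
  with Suc show ?case
    unfolding symmetric_def by (auto intro: linear_funpow simp del: funpow.simps)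
qed

lemma symmetric_nrm_le:
  assumes "symmetric K"
  shows "(nrm (K x))\<^sup>2 \<le> nrm x * nrm (K (K x))"
proof -
  have "(nrm (K x))\<^sup>2 = norm (form x (K (K x)))"
    using assms form_norm[of "K x"] by (simp add: symmetric_def)
  with form_cauchy_schwarz show ?thesis by simp
qed

text \<open>
  Iterating \<open>symmetric_nrm_le\<close> for \<open>K\<close>, \<open>K\<^sup>2\<close>, \<open>K\<^sup>4\<close> and so on: a symmetric operator whose powers are
  small is small itself.
\<close>

lemma symmetric_nrm_power_le:
  assumes K: "symmetric K"
  shows "nrm (K x) ^ 2 ^ j \<le> nrm x ^ (2 ^ j - 1) * nrm ((K ^^ 2 ^ j) x)"
proof (induction j)
  case (Suc j)
  let ?n = "2 ^ j :: nat"
  have "nrm (K x) ^ 2 ^ Suc j = (nrm (K x) ^ ?n)\<^sup>2"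
    by (simp add: power_mult[symmetric] mult.commute)
  also have "\<dots> \<le> (nrm x ^ (?n - 1) * nrm ((K ^^ ?n) x))\<^sup>2"
    by (intro power_mono Suc) (simp add: nrm_nonneg)
  also have "\<dots> \<le> nrm x ^ (?n - 1) * nrm x ^ (?n - 1) * (nrm x * nrm ((K ^^ ?n) ((K ^^ ?n) x)))"
    unfolding power2_eq_square[of "nrm x ^ (?n - 1) * nrm ((K ^^ ?n) x)"]
    using mult_left_mono[OF symmetric_nrm_le[OF symmetric_funpow[OF K, of ?n], of x],
        of "nrm x ^ (?n - 1) * nrm x ^ (?n - 1)"]
    by (simp add: nrm_nonneg power2_eq_square mult_ac)
  also have "(K ^^ ?n) ((K ^^ ?n) x) = (K ^^ 2 ^ Suc j) x"
    by (simp add: funpow_add[symmetric] mult_2 flip: o_apply[of "K ^^ ?n" "K ^^ ?n"])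
  also have "nrm x ^ (?n - 1) * nrm x ^ (?n - 1) * (nrm x * nrm ((K ^^ 2 ^ Suc j) x))
      = nrm x ^ Suc ((?n - 1) + (?n - 1)) * nrm ((K ^^ 2 ^ Suc j) x)"
    by (simp only: power_add power_Suc mult_ac)
  also have "Suc ((?n - 1) + (?n - 1)) = 2 ^ Suc j - 1"
    using one_le_power[of "2::nat" j, OF one_le_numeral] unfolding power_Suc by linarith
  finally show ?case .
qed simp

text \<open>
  Non-real numbers are not approximate eigenvalues of a symmetric operator: \<open>form x (K x)\<close> is
  self-adjoint, so \<open>- Im \<mu>\<close> times \<open>form x x\<close> is the imaginary part of \<open>form x (K x - \<mu> x)\<close>.
\<close>

lemma symmetric_below_imaginary:
  assumes K: "symmetric K"
  shows "\<bar>Im \<mu>\<bar> * nrm x \<le> nrm (K x - scale \<mu> x)"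
proof (cases "nrm x = 0")
  case False
  then have pos: "0 < nrm x" using nrm_nonneg[of x] by simp
  let ?c = "form x x" and ?p = "form x (K x) - scaleA (of_real (Re \<mu>)) (form x x)"
  have sa: "star ?c = ?c" "star (form x (K x)) = form x (K x)"
    using form_star[of x x] form_star[of "K x" x] K by (auto simp: symmetric_def)
  have "form x (K x - scale \<mu> x) = ?p - scaleA (\<i> * of_real (Im \<mu>)) ?c"
    by (subst complex_eq[of \<mu>])
       (simp add: form_diff_right form_add_right form_scale_right scale_left_distrib
          A.scale_left_distrib algebra_simps)
  moreover have "star ?p = ?p"
    using sa by (simp add: A.star_diff A.star_scaleC)
  ultimately have "\<bar>Im \<mu>\<bar> * norm ?c \<le> norm (form x (K x - scale \<mu> x))"
    using A.norm_imaginary_part_le[of ?p ?c "Im \<mu>"] sa by simp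
  also have "\<dots> \<le> nrm x * nrm (K x - scale \<mu> x)"
    by (rule form_cauchy_schwarz)
  finally have "nrm x * (\<bar>Im \<mu>\<bar> * nrm x) \<le> nrm x * nrm (K x - scale \<mu> x)"
    by (simp add: form_norm power2_eq_square mult_ac)
  with pos show ?thesis by simp
qed (simp add: nrm_nonneg)

text \<open>
  The terms of first order in \<open>s\<close> cancel in the square \<open>form (x + i s K x) (x + i s K x)\<close>.
\<close>

lemma symmetric_imaginary_step:
  assumes K: "symmetric K" and M: "\<And>x. nrm (K x) \<le> M * nrm x"
  shows "nrm (x + scale (\<i> * of_real s) (K x)) \<le> (1 + M\<^sup>2 * s\<^sup>2) * nrm x"
proof (rule power2_le_imp_le)
  have "form (x + scale (\<i> * of_real s) (K x)) (x + scale (\<i> * of_real s) (K x))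
      = form x x + scaleA (of_real (s\<^sup>2)) (form (K x) (K x))"
    using K
    by (simp add: symmetric_def form_add_right form_add_left form_scale_right form_scale_left
        A.scale_right_distrib algebra_simps power2_eq_square)
  then have "(nrm (x + scale (\<i> * of_real s) (K x)))\<^sup>2
      = norm (form x x + scaleA (of_real (s\<^sup>2)) (form (K x) (K x)))"
    by (simp add: form_norm[symmetric])
  also have "\<dots> \<le> (nrm x)\<^sup>2 + s\<^sup>2 * (nrm (K x))\<^sup>2"
    using norm_triangle_ineq[of "form x x" "scaleA (of_real (s\<^sup>2)) (form (K x) (K x))"]
    by (simp only: A.norm_scaleC form_norm) (simp add: norm_power)
  also have "\<dots> \<le> (nrm x)\<^sup>2 + s\<^sup>2 * (M * nrm x)\<^sup>2"
    using M[of x] nrm_nonneg[of "K x"] by (intro add_left_mono mult_left_mono power_mono) auto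
  also have "\<dots> \<le> ((1 + M\<^sup>2 * s\<^sup>2) * nrm x)\<^sup>2"
  proof -
    have "(1 + M\<^sup>2 * s\<^sup>2)\<^sup>2 = 1 + 2 * (M\<^sup>2 * s\<^sup>2) + (M\<^sup>2 * s\<^sup>2)\<^sup>2"
      by (simp add: power2_eq_square algebra_simps)
    then have "1 + s\<^sup>2 * M\<^sup>2 \<le> (1 + M\<^sup>2 * s\<^sup>2)\<^sup>2"
      by (simp add: mult.commute)
    then have "(1 + s\<^sup>2 * M\<^sup>2) * (nrm x)\<^sup>2 \<le> (1 + M\<^sup>2 * s\<^sup>2)\<^sup>2 * (nrm x)\<^sup>2"
      by (rule mult_right_mono) simp
    moreover have "(nrm x)\<^sup>2 + s\<^sup>2 * (M * nrm x)\<^sup>2 = (1 + s\<^sup>2 * M\<^sup>2) * (nrm x)\<^sup>2"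
      by (simp add: power_mult_distrib distrib_right)
    ultimately show ?thesis
      by (simp add: power_mult_distrib)
  qed
  finally show "(nrm (x + scale (\<i> * of_real s) (K x)))\<^sup>2 \<le> ((1 + M\<^sup>2 * s\<^sup>2) * nrm x)\<^sup>2" .
qed (simp add: nrm_nonneg)

text \<open>
  Away from the real axis the bound of \<open>symmetric_below_imaginary\<close> is good enough, and close to it
  the bound at the nearer one of the points \<open>1\<close> and \<open>- 1\<close> persists. With \<open>y = \<bar>Im w\<bar>\<close> this gives the
  constants \<open>y\<close> and \<open>\<delta> - 2 y\<close>, the larger of which is at least \<open>\<delta> / 3\<close>.
\<close>

lemma symmetric_below_on_circle:
  assumes K: "symmetric K"
    and minus: "\<And>x. \<delta> * nrm x \<le> nrm (x - K x)"
    and plus: "\<And>x. \<delta> * nrm x \<le> nrm (x + K x)"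
    and w: "cmod w = 1"
  shows "\<delta> / 3 * nrm x \<le> nrm (x - scale w (K x))"
proof -
  have sq: "(Re w)\<^sup>2 + (Im w)\<^sup>2 = 1"
    using w by (simp add: cmod_def)
  have w_cnj: "w * cnj w = 1"
    using w by (simp add: complex_mult_cnj sq flip: of_real_power of_real_add)
  have "nrm (x - scale w (K x)) = nrm (scale (- w) (K x - scale (cnj w) x))"
    by (simp add: scale_right_diff_distrib w_cnj)
  then have eq: "nrm (x - scale w (K x)) = nrm (K x - scale (cnj w) x)"
    using w by (simp add: nrm_minus nrm_scale)
  have im: "\<bar>Im w\<bar> * nrm x \<le> nrm (K x - scale (cnj w) x)"
    using symmetric_below_imaginary[OF K, of "cnj w" x] by simp
  have near: "cmod (1 - of_real \<epsilon> * cnj w) \<le> 2 * \<bar>Im w\<bar>" if "\<epsilon>\<^sup>2 = 1" "0 \<le> \<epsilon> * Re w" for \<epsilon>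
  proof (rule power2_le_imp_le)
    have "\<bar>Re w\<bar> \<le> 1" using w abs_Re_le_cmod[of w] by simp
    moreover have "\<bar>\<epsilon>\<bar> = 1" using that(1) by (auto simp: power2_eq_1_iff)
    ultimately have "\<epsilon> * Re w \<le> 1"
      by (metis abs_ge_self abs_mult mult_1 order_trans)
    then have "(\<epsilon> * Re w) * (\<epsilon> * Re w) \<le> 1 * (\<epsilon> * Re w)"
      using that(2) by (intro mult_right_mono)
    moreover have "(\<epsilon> * Re w) * (\<epsilon> * Re w) = \<epsilon>\<^sup>2 * (Re w)\<^sup>2"
      by (simp add: power2_eq_square mult_ac)
    ultimately have "(Re w)\<^sup>2 \<le> \<epsilon> * Re w"
      using that(1) by simp
    moreover have "(cmod (1 - of_real \<epsilon> * cnj w))\<^sup>2 = 2 - 2 * (\<epsilon> * Re w)"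
      using that(1) sq by (simp add: cmod_power2 power2_diff power_mult_distrib)
    moreover have "(2 * \<bar>Im w\<bar>)\<^sup>2 = 4 * (1 - (Re w)\<^sup>2)"
      using sq by (simp add: power_mult_distrib)
    ultimately show "(cmod (1 - of_real \<epsilon> * cnj w))\<^sup>2 \<le> (2 * \<bar>Im w\<bar>)\<^sup>2"
      using sq \<open>\<epsilon> * Re w \<le> 1\<close> by simp
  qed simp
  have real_pt: "(\<delta> - 2 * \<bar>Im w\<bar>) * nrm x \<le> nrm (K x - scale (cnj w) x)"
    if "\<epsilon>\<^sup>2 = 1" "0 \<le> \<epsilon> * Re w"
      "\<delta> * nrm x \<le> nrm (K x - scale (of_real \<epsilon>) x)" for \<epsilon> :: real
  proof -
    have "(of_real \<epsilon> :: complex) * of_real \<epsilon> = 1"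
      using that(1) by (simp add: power2_eq_square flip: of_real_mult)
    then have "cmod (cnj w - of_real \<epsilon>) = cmod (1 - of_real \<epsilon> * cnj w)"
      using that(1) by (metis (no_types, lifting) abs_1 abs_square_eq_1 mult_1 norm_minus_commute
          norm_mult norm_of_real power2_eq_1_iff right_diff_distrib mult.assoc)
    then have "nrm (scale (cnj w - of_real \<epsilon>) x) \<le> 2 * \<bar>Im w\<bar> * nrm x"
      using near[OF that(1,2)] by (simp add: nrm_scale mult_right_mono nrm_nonneg)
    moreover have "K x - scale (of_real \<epsilon>) x = (K x - scale (cnj w) x) + scale (cnj w - of_real \<epsilon>) x"
      by (simp add: scale_left_diff_distrib)
    ultimately show ?thesis
      using that(3) nrm_triangle[of "K x - scale (cnj w) x" "scale (cnj w - of_real \<epsilon>) x"]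
      by (simp add: algebra_simps)
  qed
  have "(\<delta> - 2 * \<bar>Im w\<bar>) * nrm x \<le> nrm (K x - scale (cnj w) x)"
  proof (cases "0 \<le> Re w")
    case True
    then show ?thesis
      using real_pt[of 1] minus[of x] nrm_minus[of "x - K x"] by simp
  next
    case False
    then show ?thesis
      using real_pt[of "-1"] plus[of x] by (simp add: add.commute)
  qed
  with im show ?thesis
    unfolding eq by (simp add: algebra_simps)
qed

text \<open>
  One of \<open>\<parallel>K\<parallel>\<close> and \<open>- \<parallel>K\<parallel>\<close> is an approximate eigenvalue of \<open>K\<close>. Otherwise \<open>K / \<parallel>K\<parallel>\<close> satisfies the
  hypothesis of \<open>resolvent_power_bound\<close> by \<open>symmetric_below_on_circle\<close>, so that its high powers are small, and by
  \<open>symmetric_nrm_power_le\<close> its norm is less than 1.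
\<close>

lemma symmetric_nrm_le_of_real_points:
  assumes K: "symmetric K"
    and M: "\<And>x. nrm (K x) \<le> M * nrm x"
    and "0 \<le> m"
    and below: "\<And>\<kappa>. m < \<kappa> \<Longrightarrow> \<exists>\<delta>>0. \<forall>x. \<delta> * nrm x \<le> nrm (scale (of_real \<kappa>) x - K x)
                              \<and> \<delta> * nrm x \<le> nrm (scale (of_real \<kappa>) x + K x)"
  shows "nrm (K x) \<le> m * nrm x"
proof -
  define B where "B = {c. 0 \<le> c \<and> (\<forall>x. nrm (K x) \<le> c * nrm x)}"
  \<comment> \<open>The infimum \<open>\<kappa>\<close> is attained and is the operator norm of \<open>K\<close>.\<close>
  define \<kappa> where "\<kappa> = Inf B"
  have "nrm (K x) \<le> max M 0 * nrm x" for x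
    using M[of x] mult_right_mono[OF max.cobounded1[of M 0] nrm_nonneg[of x]] by linarith
  then have "B \<noteq> {}" by (auto simp: B_def intro!: exI[of _ "max M 0"])
  have bdd: "bdd_below B" by (auto simp: B_def intro: bdd_belowI[of _ 0])
  have \<kappa>_nonneg: "0 \<le> \<kappa>"
    unfolding \<kappa>_def using \<open>B \<noteq> {}\<close> by (intro cInf_greatest) (auto simp: B_def)
  have K_le: "nrm (K x) \<le> \<kappa> * nrm x" for x
  proof (cases "nrm x = 0")
    case True
    then show ?thesis using M[of x] by simp
  next
    case False
    then have pos: "0 < nrm x" using nrm_nonneg[of x] by simp
    have "nrm (K x) / nrm x \<le> \<kappa>"
      unfolding \<kappa>_def using \<open>B \<noteq> {}\<close> pos
      by (intro cInf_greatest) (auto simp: B_def divide_le_eq)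
    with pos show ?thesis by (simp add: divide_le_eq)
  qed
  have "\<kappa> \<le> m"
  proof (rule ccontr)
    assume "\<not> \<kappa> \<le> m"
    then have "m < \<kappa>" by simp
    then have pos: "0 < \<kappa>" using \<open>0 \<le> m\<close> by simp
    from below[OF \<open>m < \<kappa>\<close>] obtain \<delta> where "0 < \<delta>"
      and minus: "\<And>x. \<delta> * nrm x \<le> nrm (scale (of_real \<kappa>) x - K x)"
      and plus: "\<And>x. \<delta> * nrm x \<le> nrm (scale (of_real \<kappa>) x + K x)" by blast
    define k where "k = (\<lambda>x. scale (of_real (1 / \<kappa>)) (K x))"
    have k: "symmetric k"
      using K unfolding symmetric_def k_def
      by (auto intro!: linearI
          simp: Vector_Spaces.linear_iff scale_right_distrib form_scale_left form_scale_right mult.commute)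
    have nrm_k: "nrm (k x) = nrm (K x) / \<kappa>" for x
      using pos by (simp add: k_def nrm_scale norm_divide)
    have scaled: "x - k x = scale (of_real (1 / \<kappa>)) (scale (of_real \<kappa>) x - K x)"
      "x + k x = scale (of_real (1 / \<kappa>)) (scale (of_real \<kappa>) x + K x)" for x
      using pos by (simp_all add: k_def scale_right_diff_distrib scale_right_distrib)
    have k_below: "\<delta> / \<kappa> * nrm x \<le> nrm (x - k x)" "\<delta> / \<kappa> * nrm x \<le> nrm (x + k x)" for x
      using pos minus[of x] plus[of x] unfolding scaled nrm_scale
      by (simp_all add: norm_divide divide_right_mono)
    define d where "d = \<delta> / \<kappa> / 3"
    have "0 < d" using \<open>0 < \<delta>\<close> pos by (simp add: d_def)
    have circle: "d * nrm x \<le> nrm (x - scale w (k x))" if "cmod w = 1" for w x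
      unfolding d_def by (rule symmetric_below_on_circle[OF k k_below that])
    have k_contr: "nrm (k x) \<le> nrm x" for x
      using K_le[of x] pos by (simp add: nrm_k divide_le_eq mult.commute)
    have k_lin: "Vector_Spaces.linear scale scale k"
      using k by (simp add: symmetric_def)
    define C where "C = 4 / d\<^sup>2"
    have "0 < C" using \<open>0 < d\<close> by (simp add: C_def)
    have power: "real (Suc n) * nrm ((k ^^ n) x) \<le> C * nrm x" for n x
      unfolding C_def by (rule resolvent_power_bound[OF k_lin k_contr \<open>0 < d\<close> circle])
    obtain j where j: "C < 2 ^ j"
      using real_arch_pow[of 2 C] by auto
    define N :: nat where "N = 2 ^ j"
    have "0 < N" by (simp add: N_def)
    have CN: "C / real N < 1" using j by (simp add: N_def)
    define q where "q = root N (C / real N)"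
    have q: "0 \<le> q" "q ^ N = C / real N" "q < 1"
      using \<open>0 < C\<close> \<open>0 < N\<close> CN unfolding q_def by (auto simp: real_root_lt_1_iff)
    have "nrm (k x) \<le> q * nrm x" for x
    proof -
      have "real N * nrm ((k ^^ N) x) \<le> C * nrm x"
        using power[of N x] mult_right_mono[of "real N" "real (Suc N)" "nrm ((k ^^ N) x)"]
        by (simp add: nrm_nonneg)
      then have "nrm ((k ^^ N) x) \<le> C / real N * nrm x"
        using \<open>0 < N\<close> by (simp add: field_simps)
      then have "nrm x ^ (N - 1) * nrm ((k ^^ N) x) \<le> nrm x ^ (N - 1) * (C / real N * nrm x)"
        by (intro mult_left_mono) (simp_all add: nrm_nonneg)
      also have "\<dots> = (q * nrm x) ^ N"
        using \<open>0 < N\<close> by (simp add: power_mult_distrib q(2) power_eq_if[of "nrm x" N])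
      finally have "nrm (k x) ^ N \<le> (q * nrm x) ^ N"
        using symmetric_nrm_power_le[OF k, where j = j and x = x] unfolding N_def[symmetric] by simp
      then show ?thesis
        using \<open>0 < N\<close> q(1) nrm_nonneg by (simp add: power_mono_iff)
    qed
    then have "nrm (K x) \<le> \<kappa> * q * nrm x" for x
      using pos by (simp add: nrm_k divide_le_eq mult_ac)
    then have "\<kappa> * q \<in> B" using q(1) pos by (simp add: B_def)
    then have "\<kappa> \<le> \<kappa> * q" unfolding \<kappa>_def by (rule cInf_lower[OF _ bdd])
    with pos q(3) show False by simp
  qed
  then show ?thesis
    using K_le[of x] mult_right_mono[OF _ nrm_nonneg[of x]] by (meson order_trans)
qed

text \<open>
  The preceding lemma applied to \<open>m - K\<close>: for \<open>\<kappa> > m\<close> the operator \<open>\<kappa> - (m - K)\<close> is \<open>K\<close> plus a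
  positive number, and \<open>\<kappa> + (m - K)\<close> is bounded below because \<open>\<parallel>K\<parallel> \<le> m\<close>.
\<close>

lemma symmetric_contraction:
  assumes K: "symmetric K"
    and le: "\<And>x. nrm (K x) \<le> m * nrm x" and m: "0 \<le> m"
    and below: "\<And>r. 0 < r \<Longrightarrow> \<exists>\<delta>>0. \<forall>x. \<delta> * nrm x \<le> nrm (scale (of_real r) x + K x)"
    and t: "m \<le> t"
  shows "nrm (scale (of_real t) x - K x) \<le> t * nrm x"
proof -
  define L where "L = (\<lambda>x. scale (of_real m) x - K x)"
  have L: "symmetric L"
    using K unfolding symmetric_def L_def
    by (auto intro!: linearI simp: Vector_Spaces.linear_iff scale_right_distrib scale_right_diff_distrib
        form_diff_left form_diff_right form_scale_left form_scale_right mult.commute)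
  have L_bound: "nrm (L x) \<le> 2 * m * nrm x" for x
    using nrm_triangle_diff[of "scale (of_real m) x" "K x"] le[of x] m by (simp add: L_def nrm_scale)
  have L_below: "\<exists>\<delta>>0. \<forall>x. \<delta> * nrm x \<le> nrm (scale (of_real \<kappa>) x - L x)
                    \<and> \<delta> * nrm x \<le> nrm (scale (of_real \<kappa>) x + L x)" if "m < \<kappa>" for \<kappa>
  proof -
    have "0 < \<kappa> - m" "0 < \<kappa>" using that m by simp_all
    from below[OF this(1)] obtain \<delta>
      where \<delta>: "0 < \<delta>" "\<And>x. \<delta> * nrm x \<le> nrm (scale (of_real (\<kappa> - m)) x + K x)" by blast
    have minus: "scale (of_real \<kappa>) x - L x = scale (of_real (\<kappa> - m)) x + K x" for x
      by (simp add: L_def scale_left_diff_distrib)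
    have plus: "\<kappa> * nrm x \<le> nrm (scale (of_real \<kappa>) x + L x)" for x
    proof -
      have eq: "scale (of_real \<kappa>) x + L x = scale (of_real (\<kappa> + m)) x - K x"
        by (simp add: L_def scale_left_distrib)
      have "nrm (scale (of_real (\<kappa> + m)) x) = \<kappa> * nrm x + m * nrm x"
        using m \<open>0 < \<kappa>\<close> by (simp only: nrm_scale norm_of_real) (simp add: distrib_right)
      then show ?thesis
        unfolding eq using nrm_reverse_triangle[of "scale (of_real (\<kappa> + m)) x" "K x"] le[of x]
        by linarith
    qed
    show ?thesis
    proof (intro exI[of _ "min \<delta> \<kappa>"] conjI allI)
      fix x :: 'z
      have "min \<delta> \<kappa> * nrm x \<le> \<delta> * nrm x" "min \<delta> \<kappa> * nrm x \<le> \<kappa> * nrm x"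
        by (simp_all add: mult_right_mono nrm_nonneg)
      then show "min \<delta> \<kappa> * nrm x \<le> nrm (scale (of_real \<kappa>) x - L x)"
        "min \<delta> \<kappa> * nrm x \<le> nrm (scale (of_real \<kappa>) x + L x)"
        using \<delta>(2)[of x] plus[of x] unfolding minus by (meson order_trans)+
    qed (use \<delta> \<open>0 < \<kappa>\<close> in simp)
  qed
  have "nrm (L x) \<le> m * nrm x"
    by (rule symmetric_nrm_le_of_real_points[OF L L_bound m L_below])
  moreover have "scale (of_real t) x - K x = scale (of_real (t - m)) x + L x"
    by (simp add: L_def scale_left_diff_distrib)
  moreover have "nrm (scale (of_real (t - m)) x) = t * nrm x - m * nrm x"
    using t by (simp only: nrm_scale norm_of_real) (simp add: left_diff_distrib)
  ultimately show ?thesis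
    using nrm_triangle[of "scale (of_real (t - m)) x" "L x"] by simp
qed

end

section \<open>Positive elements\<close>

context c_star_algebra
begin

lemma c_star_form: "c_star_form scaleC star scaleC norm (\<lambda>a b. star a * b)"
proof -
  interpret complex_normed_space scaleC norm by (rule complex_normed_space)
  show ?thesis
    by unfold_locales
       (auto simp: distrib_left scaleC_mult_right star_mult star_star c_star_identity norm_star_mult_le)
qed

interpretation self: c_star_form scaleC star scaleC norm "\<lambda>a b. star a * b"
  by (rule c_star_form)

lemma symmetric_left_mult:
  assumes "star h = h"
  shows "self.symmetric (\<lambda>x. h * x)"
  using assms unfolding self.symmetric_def
  by (auto intro!: self.linearI simp: distrib_left scaleC_mult_right star_mult mult.assoc)

lemma positive_star: "positive h \<Longrightarrow> star h = h"
  by (simp add: positive_def)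

text \<open>
  An inverse of \<open>r + h\<close> in the unitization acts on the algebra by left multiplication.
\<close>

lemma positive_resolvent_below:
  assumes "positive h" "0 < r"
  shows "\<exists>\<delta>>0. \<forall>x. \<delta> * norm x \<le> norm (r *\<^sub>R x + h * x)"
proof -
  have "- of_real r \<notin> spectrum h"
    using assms by (auto simp: positive_def complex_nonneg_Reals_iff)
  then obtain u where u: "unitization_mult u (h, of_real r) = (0, 1)"
    unfolding spectrum_def by auto
  obtain b \<beta> where [simp]: "u = (b, \<beta>)" by (cases u)
  have inv: "b * h + r *\<^sub>R b + scaleC \<beta> h = 0" "\<beta> * of_real r = 1"
    using u by (simp_all add: unitization_mult_def scaleC_of_real)
  have le: "norm x \<le> (norm b + cmod \<beta> + 1) * norm (r *\<^sub>R x + h * x)" for x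
  proof -
    let ?y = "r *\<^sub>R x + h * x"
    have "b * ?y + scaleC \<beta> ?y = (b * h + r *\<^sub>R b + scaleC \<beta> h) * x + scaleC (\<beta> * of_real r) x"
      by (simp add: distrib_left distrib_right scale_right_distrib scaleC_mult_left mult.assoc
          flip: scaleC_of_real)
         (simp add: scaleC_of_real)
    then have "x = b * ?y + scaleC \<beta> ?y"
      by (simp add: inv)
    then have "norm x \<le> norm (b * ?y) + norm (scaleC \<beta> ?y)"
      by (metis norm_triangle_ineq)
    also have "\<dots> \<le> norm b * norm ?y + cmod \<beta> * norm ?y"
      by (intro add_mono norm_mult_ineq) (simp add: norm_scaleC)
    also have "\<dots> \<le> (norm b + cmod \<beta> + 1) * norm ?y"
      by (simp add: distrib_right)
    finally show ?thesis .
  qed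
  have pos: "0 < norm b + cmod \<beta> + 1"
    by (simp add: add_nonneg_pos)
  show ?thesis
  proof (intro exI conjI allI)
    show "0 < 1 / (norm b + cmod \<beta> + 1)" using pos by simp
    show "1 / (norm b + cmod \<beta> + 1) * norm x \<le> norm (r *\<^sub>R x + h * x)" for x
      using le[of x] pos by (simp add: divide_le_eq mult.commute)
  qed
qed

lemma positive_contraction:
  assumes h: "positive h" and t: "norm h \<le> t"
  shows "norm (t *\<^sub>R x - h * x) \<le> t * norm x"
  using self.symmetric_contraction[OF symmetric_left_mult[OF positive_star[OF h]]
      norm_mult_ineq norm_ge_zero _ t] positive_resolvent_below[OF h]
  by (simp add: scaleC_of_real)

lemma positive_contraction_right:
  assumes h: "positive h" and t: "norm h \<le> t"
  shows "norm (t *\<^sub>R x - x * h) \<le> t * norm x"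
proof -
  have "star (t *\<^sub>R x - x * h) = t *\<^sub>R star x - h * star x"
    by (simp add: star_diff star_mult positive_star[OF h] star_scaleC flip: scaleC_of_real)
  then show ?thesis
    using positive_contraction[OF h t, of "star x"] by (metis norm_star)
qed

text \<open>
  For \<open>\<kappa> > \<parallel>b\<parallel>\<close> write \<open>\<kappa> - k = (\<kappa> - b) + (b - k)\<close>. By \<open>positive_contraction\<close>, adding a positive
  element to \<open>\<kappa> - b\<close> does not spoil its lower bound \<open>\<kappa> - \<parallel>b\<parallel>\<close>. The same holds for \<open>- k\<close>, so neither
  \<open>\<kappa>\<close> nor \<open>- \<kappa>\<close> is an approximate eigenvalue of multiplication by \<open>k\<close>.
\<close>

lemma norm_le_of_positive_add_diff:
  assumes plus: "positive (b + k)" and minus: "positive (b - k)" and k: "star k = k"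
  shows "norm k \<le> norm b"
proof -
  have below: "(\<kappa> - norm b) * norm x \<le> norm (\<kappa> *\<^sub>R x - c * x)"
    if c: "positive (b - c)" and \<kappa>: "norm b < \<kappa>" for c \<kappa> x
  proof -
    define t where "t = norm (b - c)"
    have "0 \<le> t" by (simp add: t_def)
    have "0 < \<kappa>" using \<kappa> norm_ge_zero[of b] by linarith
    have "(t + \<kappa>) *\<^sub>R x = (\<kappa> *\<^sub>R x - c * x) + (t *\<^sub>R x - (b - c) * x) + b * x"
      by (simp add: scaleR_left_distrib left_diff_distrib)
    then have "norm ((t + \<kappa>) *\<^sub>R x)
        \<le> norm (\<kappa> *\<^sub>R x - c * x) + norm (t *\<^sub>R x - (b - c) * x) + norm (b * x)"
      by (metis norm_triangle_le norm_triangle_ineq add_right_mono)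
    also have "\<dots> \<le> norm (\<kappa> *\<^sub>R x - c * x) + t * norm x + norm b * norm x"
      by (intro add_mono order_refl positive_contraction[OF c] norm_mult_ineq) (simp add: t_def)
    finally have "(t + \<kappa>) * norm x \<le> norm (\<kappa> *\<^sub>R x - c * x) + t * norm x + norm b * norm x"
      using \<open>0 < \<kappa>\<close> \<open>0 \<le> t\<close> by simp
    then show ?thesis
      by (simp add: distrib_right left_diff_distrib)
  qed
  have "norm (k * x) \<le> norm b * norm x" for x
  proof (rule self.symmetric_nrm_le_of_real_points[where M = "norm k", OF symmetric_left_mult[OF k]])
    fix \<kappa> assume \<kappa>: "norm b < \<kappa>"
    show "\<exists>\<delta>>0. \<forall>x. \<delta> * norm x \<le> norm (scaleC (of_real \<kappa>) x - k * x)
        \<and> \<delta> * norm x \<le> norm (scaleC (of_real \<kappa>) x + k * x)"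
      using below[of k \<kappa>] below[of "- k" \<kappa>] plus minus \<kappa>
      by (intro exI[of _ "\<kappa> - norm b"]) (simp add: scaleC_of_real)
  qed (simp_all add: norm_mult_ineq)
  from this[of k] have "norm k * norm k \<le> norm b * norm k"
    using c_star_identity[of k] by (simp add: k power2_eq_square)
  then show ?thesis
    by (cases "k = 0") auto
qed

end

section \<open>The norm of an inner product module\<close>

context inner_product_module
begin

lemma ip_add_right: "ip x (y + z) = ip x y + ip x z"
  using inner_linear[of x 1 y 1 z] by simp

lemma ip_scale_right: "ip x (scaleE \<alpha> y) = scaleA \<alpha> (ip x y)"
  using inner_linear[of x \<alpha> y 0 0] by simp

lemma ip_add_left: "ip (x + y) z = ip x z + ip y z"
  by (metis inner_star ip_add_right A.star_add)

lemma ip_scale_left: "ip (scaleE \<alpha> x) z = scaleA (cnj \<alpha>) (ip x z)"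
  by (metis inner_star ip_scale_right A.star_scaleC)

lemma ip_act_left: "ip (act x a) y = star a * ip x y"
  by (metis inner_star inner_act A.star_mult)

lemma ip_diff_right: "ip x (y - z) = ip x y - ip x z"
  using ip_add_right[of x "y - z" z] by simp

lemma ip_diff_left: "ip (x - y) z = ip x z - ip y z"
  using ip_add_left[of "x - y" y z] by simp

lemma ip_0_left [simp]: "ip 0 x = 0"
  using ip_diff_left[of x x x] by simp

lemma star_ip_self: "star (ip x x) = ip x x"
  by (rule inner_star[symmetric])

abbreviation nrm :: "'e \<Rightarrow> real" where
  "nrm \<equiv> module_norm ip"

lemma nrm_square: "(nrm x)\<^sup>2 = norm (ip x x)"
  by (simp add: module_norm_def)

lemma module_norm_nonneg: "0 \<le> nrm x"
  by (simp add: module_norm_def)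

lemma nrm_eq_0_iff: "nrm x = 0 \<longleftrightarrow> x = 0"
  using inner_definite[of x] by (auto simp: module_norm_def)

lemma nrm_scaleE: "nrm (scaleE \<alpha> x) = cmod \<alpha> * nrm x"
  by (simp add: module_norm_def ip_scale_left ip_scale_right A.norm_scaleC norm_mult real_sqrt_mult)

lemma nrm_act_le: "nrm (act x b) \<le> nrm x * norm b"
proof (rule power2_le_imp_le)
  have "(nrm (act x b))\<^sup>2 = norm (star b * (ip x x * b))"
    by (simp add: nrm_square ip_act_left inner_act mult.assoc)
  also have "\<dots> \<le> norm b * (norm (ip x x) * norm b)"
    using A.norm_star_mult_le[of b "ip x x * b"] mult_left_mono[OF norm_mult_ineq norm_ge_zero]
    by (rule order_trans)
  finally show "(nrm (act x b))\<^sup>2 \<le> (nrm x * norm b)\<^sup>2"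
    by (simp add: power_mult_distrib nrm_square power2_eq_square[of "norm b"] mult_ac)
qed (simp add: module_norm_nonneg)

text \<open>
  The inner squares of \<open>\<beta> x + \<alpha> y\<close> and \<open>\<beta> x - \<alpha> y\<close> are \<open>b + k\<close> and \<open>b - k\<close>, where \<open>k\<close> is \<open>\<alpha> \<beta>\<close> times the
  element in question. The weights \<open>\<alpha> = \<parallel>x\<parallel>\<close> and \<open>\<beta> = \<parallel>y\<parallel>\<close> give both terms of \<open>b\<close> the norm \<open>\<alpha>\<^sup>2 \<beta>\<^sup>2\<close>.
\<close>

lemma norm_ip_add_swap_le: "norm (ip x y + ip y x) \<le> 2 * (nrm x * nrm y)"
proof (cases "nrm x = 0 \<or> nrm y = 0")
  case True
  then have "ip x y = 0 \<and> ip y x = 0"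
    using inner_star[of x y] inner_star[of y x] by (auto simp: nrm_eq_0_iff)
  then show ?thesis by (simp add: module_norm_nonneg)
next
  case False
  define \<alpha> \<beta> where "\<alpha> = nrm x" and "\<beta> = nrm y"
  have pos: "0 < \<alpha>" "0 < \<beta>"
    using False module_norm_nonneg[of x] module_norm_nonneg[of y] by (auto simp: \<alpha>_def \<beta>_def)
  define b where "b = \<beta>\<^sup>2 *\<^sub>R ip x x + \<alpha>\<^sup>2 *\<^sub>R ip y y"
  define k where "k = (\<alpha> * \<beta>) *\<^sub>R (ip x y + ip y x)"
  let ?x = "scaleE (of_real \<beta>) x" and ?y = "scaleE (of_real \<alpha>) y"
  have "b + k = ip (?x + ?y) (?x + ?y)" "b - k = ip (?x - ?y) (?x - ?y)"
    by (simp_all add: b_def k_def ip_add_left ip_add_right ip_diff_left ip_diff_right ip_scale_left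
        ip_scale_right A.scaleC_of_real scaleR_add_right scaleR_diff_right power2_eq_square
        mult.commute)
  then have "A.positive (b + k)" "A.positive (b - k)"
    using inner_positive by auto
  moreover have "star k = k"
    using inner_star[of x y] inner_star[of y x]
    by (simp add: k_def A.star_add A.star_scaleC add.commute flip: A.scaleC_of_real)
  ultimately have "norm k \<le> norm b"
    by (rule A.norm_le_of_positive_add_diff)
  also have "norm b \<le> \<beta>\<^sup>2 * \<alpha>\<^sup>2 + \<alpha>\<^sup>2 * \<beta>\<^sup>2"
    unfolding b_def by (rule norm_triangle_le) (simp add: \<alpha>_def \<beta>_def nrm_square)
  also have "norm k = (\<alpha> * \<beta>) * norm (ip x y + ip y x)"
    using pos by (simp add: k_def)
  finally have "(\<alpha> * \<beta>) * norm (ip x y + ip y x) \<le> (\<alpha> * \<beta>) * (2 * (\<alpha> * \<beta>))"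
    by (simp add: power2_eq_square mult_ac)
  then show ?thesis
    using pos by (simp add: \<alpha>_def \<beta>_def)
qed

text \<open>
  Replacing \<open>x\<close> by \<open>x.u\<close> with \<open>u = \<langle>x, y\<rangle>\<close> turns \<open>\<langle>y, x\<rangle>\<close> into the self-adjoint element \<open>u\<^sup>* u\<close>, for
  which the symmetrized bound of \<open>norm_ip_add_swap_le\<close> loses nothing.
\<close>

lemma cauchy_schwarz: "norm (ip x y) \<le> nrm x * nrm y"
proof (cases "ip x y = 0")
  case False
  define u where "u = ip x y"
  have "ip y (act x u) = star u * u" "ip (act x u) y = star u * u"
    using inner_star[of x y] by (simp_all add: inner_act ip_act_left u_def A.star_star)
  then have "2 * (norm u)\<^sup>2 = norm (ip (act x u) y + ip y (act x u))"
    by (simp add: scaleR_2[symmetric] A.c_star_identity)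
  also have "\<dots> \<le> 2 * (nrm (act x u) * nrm y)"
    by (rule norm_ip_add_swap_le)
  also have "\<dots> \<le> 2 * (nrm x * norm u * nrm y)"
    by (simp add: mult_right_mono nrm_act_le module_norm_nonneg)
  finally have "norm u * norm u \<le> norm u * (nrm x * nrm y)"
    by (simp add: power2_eq_square mult_ac)
  with False show ?thesis by (simp add: u_def)
qed (simp add: module_norm_nonneg)

lemma module_norm_triangle: "nrm (x + y) \<le> nrm x + nrm y"
proof (rule power2_le_imp_le)
  have "(nrm (x + y))\<^sup>2 = norm ((ip x x + ip y y) + (ip x y + ip y x))"
    by (simp add: nrm_square ip_add_left ip_add_right add_ac)
  also have "\<dots> \<le> ((nrm x)\<^sup>2 + (nrm y)\<^sup>2) + 2 * (nrm x * nrm y)"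
    unfolding nrm_square
    by (intro norm_triangle_le add_mono norm_triangle_ineq norm_ip_add_swap_le)
  finally show "(nrm (x + y))\<^sup>2 \<le> (nrm x + nrm y)\<^sup>2"
    by (simp add: power2_eq_square algebra_simps)
qed (simp add: module_norm_nonneg)

lemma complex_normed_space: "complex_normed_space scaleE nrm"
  by unfold_locales (simp_all add: nrm_eq_0_iff module_norm_triangle nrm_scaleE)

lemma c_star_form: "c_star_form scaleA star scaleE nrm ip"
proof -
  interpret complex_normed_space scaleE nrm by (rule complex_normed_space)
  show ?thesis
    by unfold_locales
       (simp_all add: ip_add_right ip_scale_right inner_star[symmetric] nrm_square cauchy_schwarz)
qed

end

section \<open>Power series of operators\<close>

lemma tendsto_suminf_tail:
  fixes f :: "nat \<Rightarrow> real"
  assumes "summable f"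
  shows "(\<lambda>n. \<Sum>k. f (k + n)) \<longlonglongrightarrow> 0"
proof -
  have "(\<lambda>n. suminf f - sum f {..<n}) \<longlonglongrightarrow> suminf f - suminf f"
    by (intro tendsto_diff tendsto_const summable_LIMSEQ assms)
  then show ?thesis
    using suminf_minus_initial_segment[OF assms] by simp
qed

context complex_banach_space
begin

lemma eq_if_nrm_diff_tendsto_0:
  assumes "r \<longlonglongrightarrow> 0" "\<And>n. nrm (x - y) \<le> r n"
  shows "x = y"
proof -
  have "nrm (x - y) \<le> 0"
    using assms(2) by (intro LIMSEQ_le_const[OF assms(1)]) auto
  then show ?thesis
    using nrm_nonneg[of "x - y"] by (simp add: nrm_eq_0)
qed

lemma absolutely_convergent_series:
  assumes f: "summable (\<lambda>k. nrm (f k))"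
  obtains l where "\<And>n. nrm (l - (\<Sum>k<n. f k)) \<le> (\<Sum>k. nrm (f (k + n)))"
proof -
  define \<sigma> where "\<sigma> = (\<lambda>n. \<Sum>k<n. f k)"
  have dist: "nrm (\<sigma> n - \<sigma> m) \<le> (\<Sum>k\<in>{m..<n}. nrm (f k))" if "m \<le> n" for m n
  proof -
    have "\<sigma> n - \<sigma> m = (\<Sum>k\<in>{m..<n}. f k)"
      using that unfolding \<sigma>_def lessThan_atLeast0 by (simp add: sum_diff_nat_ivl)
    then show ?thesis using nrm_sum by simp
  qed
  have "metric.MCauchy \<sigma>"
    unfolding metric.MCauchy_def
  proof (intro conjI allI impI)
    fix \<epsilon> :: real assume "0 < \<epsilon>"
    then obtain N where N: "\<And>m n. N \<le> m \<Longrightarrow> norm (\<Sum>k\<in>{m..<n}. nrm (f k)) < \<epsilon>"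
      using f unfolding summable_Cauchy by blast
    have "nrm (\<sigma> n - \<sigma> m) < \<epsilon>" if "N \<le> m" "m \<le> n" for m n
      using dist[OF that(2)] N[OF that(1), of n] by (auto simp: abs_less_iff)
    then have "nrm (\<sigma> n - \<sigma> n') < \<epsilon>" if "N \<le> n" "N \<le> n'" for n n'
      using that by (metis minus_diff_eq nrm_minus nat_le_linear)
    then show "\<exists>N. \<forall>n n'. N \<le> n \<longrightarrow> N \<le> n' \<longrightarrow> nrm (\<sigma> n - \<sigma> n') < \<epsilon>" by blast
  qed simp
  then obtain l where l: "limitin metric.mtopology \<sigma> l sequentially"
    using complete unfolding metric.mcomplete_def by blast
  have "nrm (l - \<sigma> n) \<le> (\<Sum>k. nrm (f (k + n)))" for n
  proof (rule field_le_epsilon)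
    fix \<epsilon> :: real assume "0 < \<epsilon>"
    then obtain N where N: "\<And>m. N \<le> m \<Longrightarrow> nrm (\<sigma> m - l) < \<epsilon>"
      using l unfolding metric.limit_metric_sequentially by blast
    define m where "m = max N n"
    have "(\<Sum>k\<in>{n..<m}. nrm (f k)) = (\<Sum>k<m - n. nrm (f (k + n)))"
      using sum.shift_bounds_nat_ivl[of "\<lambda>k. nrm (f k)" 0 n "m - n"]
      by (simp add: m_def lessThan_atLeast0)
    also have "\<dots> \<le> (\<Sum>k. nrm (f (k + n)))"
      by (rule sum_le_suminf) (auto simp: nrm_nonneg intro: summable_ignore_initial_segment f)
    finally have "nrm (\<sigma> m - \<sigma> n) \<le> (\<Sum>k. nrm (f (k + n)))"
      using dist[of n m] by (simp add: m_def)
    moreover have "nrm (l - \<sigma> m) < \<epsilon>"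
      using N[of m] nrm_minus[of "\<sigma> m - l"] by (simp add: m_def)
    ultimately show "nrm (l - \<sigma> n) \<le> (\<Sum>k. nrm (f (k + n))) + \<epsilon>"
      using nrm_triangle[of "l - \<sigma> m" "\<sigma> m - \<sigma> n"] by simp
  qed
  then show thesis unfolding \<sigma>_def by (rule that)
qed

text \<open>
  Both the exponential and the Neumann series are of this form. The explicit tail bound, which is
  uniform on the unit ball, expresses convergence in operator norm.
\<close>

lemma power_series_operator:
  assumes T: "Vector_Spaces.linear scale scale T"
    and M: "\<And>x. nrm (T x) \<le> M * nrm x" "0 \<le> M"
    and a: "summable (\<lambda>k. cmod (a k) * M ^ k)"
  obtains U where "Vector_Spaces.linear scale scale U"
    and "\<And>n z. nrm (U z - (\<Sum>k<n. scale (a k) ((T ^^ k) z)))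
                  \<le> (\<Sum>k. cmod (a (k + n)) * M ^ (k + n)) * nrm z"
    and "\<And>z. U (T z) = T (U z)"
proof -
  define S where "S = (\<lambda>n z. \<Sum>k<n. scale (a k) ((T ^^ k) z))"
  define r where "r = (\<lambda>n. \<Sum>k. cmod (a (k + n)) * M ^ (k + n))"
  have r: "r \<longlonglongrightarrow> 0"
    unfolding r_def by (rule tendsto_suminf_tail[OF a])
  have "\<exists>l. \<forall>n. nrm (l - S n z) \<le> r n * nrm z" for z
  proof -
    have le: "nrm (scale (a k) ((T ^^ k) z)) \<le> cmod (a k) * M ^ k * nrm z" for k
      using mult_left_mono[OF nrm_funpow_le[OF M, where n = k and x = z], of "cmod (a k)"]
      by (simp add: nrm_scale mult.assoc)
    have sm: "summable (\<lambda>k. cmod (a k) * M ^ k * nrm z)"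
      by (intro summable_mult2 a)
    have f: "summable (\<lambda>k. nrm (scale (a k) ((T ^^ k) z)))"
      by (rule summable_comparison_test'[OF sm, of 0]) (simp add: le nrm_nonneg)
    then obtain l where l: "\<And>n. nrm (l - S n z) \<le> (\<Sum>k. nrm (scale (a (k + n)) ((T ^^ (k + n)) z)))"
      by (rule absolutely_convergent_series) (rule that[unfolded S_def])
    have "(\<Sum>k. nrm (scale (a (k + n)) ((T ^^ (k + n)) z))) \<le> r n * nrm z" for n
    proof -
      have sn: "summable (\<lambda>k. cmod (a (k + n)) * M ^ (k + n))"
        by (rule summable_ignore_initial_segment[OF a])
      have "(\<Sum>k. nrm (scale (a (k + n)) ((T ^^ (k + n)) z)))
          \<le> (\<Sum>k. cmod (a (k + n)) * M ^ (k + n) * nrm z)"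
      proof (rule suminf_le)
        show "summable (\<lambda>k. nrm (scale (a (k + n)) ((T ^^ (k + n)) z)))"
          by (rule summable_ignore_initial_segment[OF f])
      qed (use le sn in \<open>auto intro: summable_mult2\<close>)
      also have "\<dots> = r n * nrm z"
        unfolding r_def by (rule suminf_mult2[OF sn, symmetric])
      finally show ?thesis .
    qed
    with l show ?thesis by (meson order_trans)
  qed
  then obtain U where U: "\<And>z n. nrm (U z - S n z) \<le> r n * nrm z"
    by metis
  have S_lin: "Vector_Spaces.linear scale scale (S n)" for n
    using linear_funpow[OF T] unfolding S_def
    by (intro linearI)
       (simp_all add: Vector_Spaces.linear_iff scale_right_distrib sum.distrib scale_sum_right mult.commute)
  have S_add: "S n (x + y) = S n x + S n y" and S_scale: "S n (scale c x) = scale c (S n x)" for n x y c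
    using S_lin[of n] by (auto simp: Vector_Spaces.linear_iff)
  have U_lin: "Vector_Spaces.linear scale scale U"
  proof (rule linearI)
    fix x y c
    show "U (x + y) = U x + U y"
    proof (rule eq_if_nrm_diff_tendsto_0)
      show "(\<lambda>n. r n * nrm (x + y) + r n * nrm x + r n * nrm y) \<longlonglongrightarrow> 0"
        by (auto intro!: tendsto_eq_intros r)
      fix n
      have eq: "U (x + y) - (U x + U y) = (U (x + y) - S n (x + y)) - (U x - S n x) - (U y - S n y)"
        by (simp add: S_add)
      show "nrm (U (x + y) - (U x + U y)) \<le> r n * nrm (x + y) + r n * nrm x + r n * nrm y"
        unfolding eq using nrm_triangle_diff[of "(U (x + y) - S n (x + y)) - (U x - S n x)" "U y - S n y"]
          nrm_triangle_diff[of "U (x + y) - S n (x + y)" "U x - S n x"]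
          U[of "x + y" n] U[of x n] U[of y n] by linarith
    qed
    show "U (scale c x) = scale c (U x)"
    proof (rule eq_if_nrm_diff_tendsto_0)
      show "(\<lambda>n. r n * nrm (scale c x) + cmod c * (r n * nrm x)) \<longlonglongrightarrow> 0"
        by (auto intro!: tendsto_eq_intros r)
      fix n
      have eq: "U (scale c x) - scale c (U x) = (U (scale c x) - S n (scale c x)) - scale c (U x - S n x)"
        by (simp add: S_scale scale_right_diff_distrib)
      show "nrm (U (scale c x) - scale c (U x)) \<le> r n * nrm (scale c x) + cmod c * (r n * nrm x)"
        unfolding eq using nrm_triangle_diff[of "U (scale c x) - S n (scale c x)" "scale c (U x - S n x)"]
          U[of "scale c x" n] mult_left_mono[OF U[of x n] norm_ge_zero[of c]] nrm_scale[of c "U x - S n x"]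
        by linarith
    qed
  qed
  have U_comm: "U (T z) = T (U z)" for z
  proof (rule eq_if_nrm_diff_tendsto_0)
    show "(\<lambda>n. r n * nrm (T z) + M * (r n * nrm z)) \<longlonglongrightarrow> 0"
      by (auto intro!: tendsto_eq_intros r)
    fix n
    have "S n (T z) = T (S n z)"
      unfolding S_def linear_sum[OF T] linear_scale[OF T] by (simp add: funpow_swap1)
    then have eq: "U (T z) - T (U z) = (U (T z) - S n (T z)) - T (U z - S n z)"
      by (simp add: linear_diff[OF T])
    have "nrm (T (U z - S n z)) \<le> M * (r n * nrm z)"
      using M(1)[of "U z - S n z"] mult_left_mono[OF U[of z n] M(2)] by linarith
    then show "nrm (U (T z) - T (U z)) \<le> r n * nrm (T z) + M * (r n * nrm z)"
      unfolding eq using nrm_triangle_diff[of "U (T z) - S n (T z)" "T (U z - S n z)"] U[of "T z" n]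
      by linarith
  qed
  show thesis
    by (rule that[OF U_lin U[unfolded S_def r_def] U_comm])
qed

lemma op_norm_bounds:
  assumes "\<And>z. nrm (D z) \<le> c * nrm z" "0 \<le> c"
  shows "op_norm D \<le> c" "0 \<le> op_norm D" "nrm z \<le> 1 \<Longrightarrow> nrm (D z) \<le> op_norm D"
proof -
  have le: "nrm (D z) \<le> c" if "nrm z \<le> 1" for z
    using assms(1)[of z] mult_left_mono[OF that assms(2)] by simp
  then show "op_norm D \<le> c"
    unfolding op_norm_def by (intro cSUP_least) (auto intro!: exI[of _ 0])
  have bdd: "bdd_above ((\<lambda>z. nrm (D z)) ` {z. nrm z \<le> 1})"
    using le by (auto intro!: bdd_aboveI[of _ c])
  then show upper: "nrm (D z) \<le> op_norm D" if "nrm z \<le> 1" for z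
    unfolding op_norm_def using that by (intro cSUP_upper) auto
  show "0 \<le> op_norm D"
    using upper[of 0] nrm_nonneg[of "D 0"] by simp
qed

lemma nrm_le_op_norm:
  assumes D: "Vector_Spaces.linear scale scale D" and c: "\<And>z. nrm (D z) \<le> c * nrm z" "0 \<le> c"
  shows "nrm (D z) \<le> op_norm D * nrm z"
proof (cases "nrm z = 0")
  case True
  then show ?thesis using c(1)[of z] by simp
next
  case False
  then have pos: "0 < nrm z" using nrm_nonneg[of z] by simp
  have "nrm (D (scale (of_real (1 / nrm z)) z)) \<le> op_norm D"
    using pos by (intro op_norm_bounds(3)[OF c]) (simp add: nrm_scale norm_divide)
  then show ?thesis
    using pos by (simp add: linear_scale[OF D] nrm_scale norm_divide divide_le_eq)
qed

lemma bounded_opE: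
  assumes "bounded_op T"
  obtains M where "Vector_Spaces.linear scale scale T" "\<And>x. nrm (T x) \<le> M * nrm x" "0 \<le> M"
proof -
  from assms obtain K where K: "\<And>z. nrm (T z) \<le> K * nrm z" and T: "Vector_Spaces.linear scale scale T"
    unfolding bounded_op_def by blast
  have "nrm (T z) \<le> max K 0 * nrm z" for z
    using K[of z] mult_right_mono[OF max.cobounded1[of K 0] nrm_nonneg[of z]] by linarith
  then show thesis using that[OF T, of "max K 0"] by simp
qed

text \<open>
  The sum provided by \<open>power_series_operator\<close> is the only operator to which the exponential series
  converges in operator norm, so the definite description in \<open>op_exp\<close> denotes it.
\<close>

lemma op_exp_approx:
  assumes T: "Vector_Spaces.linear scale scale T"
    and M: "\<And>x. nrm (T x) \<le> M * nrm x" "0 \<le> M"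
  shows "nrm (op_exp T z - (\<Sum>k<n. scale (1 / fact k) ((T ^^ k) z)))
           \<le> (\<Sum>k. M ^ (k + n) / fact (k + n)) * nrm z"
proof -
  define S where "S = (\<lambda>n z. \<Sum>k<n. scale (1 / fact k) ((T ^^ k) z))"
  define r where "r = (\<lambda>n. \<Sum>k. M ^ (k + n) / fact (k + n))"
  have sm: "summable (\<lambda>k. M ^ k / fact k)"
    using summable_exp[of M] by (simp add: field_simps)
  have coeff: "cmod (1 / fact k) * M ^ k = M ^ k / fact k" for k
    by (simp add: norm_divide)
  have "summable (\<lambda>k. cmod (1 / fact k) * M ^ k)"
    using sm by (simp only: coeff)
  then obtain U where U: "Vector_Spaces.linear scale scale U"
    "\<And>n z. nrm (U z - S n z) \<le> r n * nrm z"
    by (rule power_series_operator[OF T M]) (rule that[unfolded S_def r_def coeff[symmetric]])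
  have r: "r \<longlonglongrightarrow> 0"
    unfolding r_def by (rule tendsto_suminf_tail[OF sm])
  have r_nonneg: "0 \<le> r n" for n
    unfolding r_def using M(2) by (intro suminf_nonneg summable_ignore_initial_segment[OF sm]) simp
  have S_lin: "Vector_Spaces.linear scale scale (S n)" for n
    using linear_funpow[OF T] unfolding S_def
    by (intro linearI)
       (simp_all add: Vector_Spaces.linear_iff scale_right_distrib sum.distrib scale_sum_right mult.commute)
  have "bounded_op U"
    unfolding bounded_op_def using U(1) U(2)[of _ 0] by (auto simp: S_def)
  have U_lim: "(\<lambda>n. op_norm (\<lambda>z. U z - S n z)) \<longlonglongrightarrow> 0"
    by (rule tendsto_sandwich[OF _ _ tendsto_const r])
       (auto intro!: always_eventually op_norm_bounds[where c = "r _"] U r_nonneg)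
  have "op_exp T = U"
    unfolding op_exp_def
  proof (rule the_equality)
    show "bounded_op U \<and> (\<lambda>n. op_norm (\<lambda>z. U z - (\<Sum>k<n. scale (1 / fact k) ((T ^^ k) z)))) \<longlonglongrightarrow> 0"
      using \<open>bounded_op U\<close> U_lim by (simp add: S_def)
  next
    fix V assume V: "bounded_op V \<and> (\<lambda>n. op_norm (\<lambda>z. V z - (\<Sum>k<n. scale (1 / fact k) ((T ^^ k) z)))) \<longlonglongrightarrow> 0"
    then have V_lim: "(\<lambda>n. op_norm (\<lambda>z. V z - S n z)) \<longlonglongrightarrow> 0" by (simp add: S_def)
    from V have "bounded_op V" by simp
    then obtain c where V_lin: "Vector_Spaces.linear scale scale V"
      and c: "\<And>x. nrm (V x) \<le> c * nrm x" "0 \<le> c"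
      by (rule bounded_opE) (rule that)
    from \<open>bounded_op U\<close> obtain d where d: "\<And>x. nrm (U x) \<le> d * nrm x" "0 \<le> d"
      by (rule bounded_opE) (rule that)
    show "V = U"
    proof
      fix z
      show "V z = U z"
      proof (rule eq_if_nrm_diff_tendsto_0)
        show "(\<lambda>n. op_norm (\<lambda>z. V z - S n z) * nrm z + r n * nrm z) \<longlonglongrightarrow> 0"
          by (auto intro!: tendsto_eq_intros r V_lim)
        fix n
        have lin: "Vector_Spaces.linear scale scale (\<lambda>z. V z - S n z)"
          using V_lin S_lin[of n] by (intro linearI) (simp_all add: Vector_Spaces.linear_iff scale_right_diff_distrib)
        have "nrm (V x - S n x) \<le> (c + d + r n) * nrm x" for x
          using nrm_triangle[of "V x - U x" "U x - S n x"] nrm_triangle_diff[of "V x" "U x"] c(1)[of x] d(1)[of x] U(2)[of x n]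
          by (simp add: distrib_right)
        then have "nrm (V z - S n z) \<le> op_norm (\<lambda>z. V z - S n z) * nrm z"
          using nrm_le_op_norm[OF lin, of "c + d + r n"] c(2) d(2) r_nonneg[of n] by simp
        then show "nrm (V z - U z) \<le> op_norm (\<lambda>z. V z - S n z) * nrm z + r n * nrm z"
          using nrm_triangle_diff[of "V z - S n z" "U z - S n z"] U(2)[of z n] by simp
      qed
    qed
  qed
  then show ?thesis
    using U(2)[of z n] by (simp add: S_def r_def)
qed

end

section \<open>Hermitian operators and nonnegative spectra\<close>

lemma power_taylor_remainder_le:
  fixes s t R :: real
  assumes "\<bar>t\<bar> \<le> R" "\<bar>s\<bar> \<le> R" "1 \<le> R"
  shows "\<bar>(t + s) ^ Suc k - t ^ Suc k - real (Suc k) * s * t ^ k\<bar> \<le> s\<^sup>2 * (4 * R) ^ Suc k"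
proof (induction k)
  case 0
  then show ?case using assms by simp
next
  case (Suc k)
  let ?e = "\<lambda>k. (t + s) ^ Suc k - t ^ Suc k - real (Suc k) * s * t ^ k"
  have rec: "?e (Suc k) = (t + s) * ?e k + real (Suc k) * s\<^sup>2 * t ^ k"
    by (simp add: power2_eq_square algebra_simps)
  have "\<bar>(t + s) * ?e k\<bar> \<le> (2 * R) * (s\<^sup>2 * (4 * R) ^ Suc k)"
    unfolding abs_mult using assms by (intro mult_mono Suc) auto
  moreover have "\<bar>real (Suc k) * s\<^sup>2 * t ^ k\<bar> \<le> (2 * R) * (s\<^sup>2 * (4 * R) ^ Suc k)"
  proof -
    have "real (Suc k) \<le> 2 ^ Suc k"
      by (metis less_exp less_imp_le of_nat_le_iff of_nat_numeral of_nat_power)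
    also have "(2::real) ^ Suc k \<le> 4 ^ Suc k"
      by (intro power_mono) auto
    finally have k: "real (Suc k) \<le> 4 ^ Suc k" .
    have "\<bar>t\<bar> ^ k \<le> R ^ k"
      using assms by (intro power_mono) auto
    also have "R ^ k \<le> 2 * R * R ^ Suc k"
      using assms power_increasing[of k "Suc (Suc k)" R] zero_le_power[of R "Suc (Suc k)"] by simp
    finally have t: "\<bar>t\<bar> ^ k \<le> 2 * R * R ^ Suc k" .
    have "\<bar>real (Suc k) * s\<^sup>2 * t ^ k\<bar> = real (Suc k) * \<bar>t\<bar> ^ k * s\<^sup>2"
      by (simp add: abs_mult power_abs)
    also have "\<dots> \<le> (4 ^ Suc k * (2 * R * R ^ Suc k)) * s\<^sup>2"
      by (intro mult_right_mono mult_mono k t) auto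
    finally show ?thesis
      by (simp add: power_mult_distrib mult_ac)
  qed
  ultimately have "\<bar>?e (Suc k)\<bar> \<le> 2 * ((2 * R) * (s\<^sup>2 * (4 * R) ^ Suc k))"
    unfolding rec using abs_triangle_ineq[of "(t + s) * ?e k" "real (Suc k) * s\<^sup>2 * t ^ k"] by linarith
  then show ?case
    by (simp add: mult_ac)
qed

text \<open>
  Exchanging the end points turns the one-sided bound into \<open>\<bar>f (x + h) - f x\<bar> \<le> D h\<^sup>2\<close>, so the derivative
  vanishes.
\<close>

lemma constant_if_quadratic_increments:
  fixes f :: "real \<Rightarrow> real"
  assumes "\<And>R. 1 \<le> R \<Longrightarrow> \<exists>D. \<forall>t s. \<bar>t\<bar> \<le> R \<longrightarrow> \<bar>s\<bar> \<le> R \<longrightarrow> f (t + s) \<le> f t + D * s\<^sup>2"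
  shows "f t = f 0"
proof (rule DERIV_isconst_all[where f = f])
  show "\<forall>x. DERIV f x :> 0"
  proof
    fix x
    obtain D where D: "\<And>t s. \<bar>t\<bar> \<le> \<bar>x\<bar> + 1 \<Longrightarrow> \<bar>s\<bar> \<le> \<bar>x\<bar> + 1 \<Longrightarrow> f (t + s) \<le> f t + D * s\<^sup>2"
      using assms[of "\<bar>x\<bar> + 1"] by auto
    have quad: "\<bar>f (x + h) - f x\<bar> \<le> D * h\<^sup>2" if "\<bar>h\<bar> < 1" for h
    proof -
      have "\<bar>h\<bar> \<le> \<bar>x\<bar> + 1" "\<bar>x + h\<bar> \<le> \<bar>x\<bar> + 1"
        using that by linarith+
      then show ?thesis
        using D[of x h] D[of "x + h" "- h"] by (simp add: abs_le_iff)
    qed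
    have "norm ((f (x + h) - f x) / h) \<le> \<bar>D\<bar> * \<bar>h\<bar>" if "\<bar>h\<bar> < 1" "h \<noteq> 0" for h
    proof -
      have "\<bar>f (x + h) - f x\<bar> \<le> \<bar>D\<bar> * \<bar>h\<bar> * \<bar>h\<bar>"
        using quad[OF that(1)]
          mult_right_mono[OF abs_ge_self[of D] zero_le_power2[of h]]
        by (simp add: power2_eq_square mult.assoc)
      then show ?thesis using that(2) by (simp add: divide_le_eq)
    qed
    then have "eventually (\<lambda>h. norm ((f (x + h) - f x) / h) \<le> \<bar>D\<bar> * \<bar>h\<bar>) (at 0)"
      by (auto simp: eventually_at dist_real_def intro!: exI[of _ 1])
    moreover have "((\<lambda>h. \<bar>D\<bar> * \<bar>h\<bar>) \<longlongrightarrow> 0) (at (0::real))"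
      by (auto intro!: tendsto_eq_intros)
    ultimately have "((\<lambda>h. (f (x + h) - f x) / h) \<longlongrightarrow> 0) (at 0)"
      by (rule Lim_null_comparison)
    then show "DERIV f x :> 0"
      by (simp add: DERIV_def)
  qed
qed

context complex_banach_space
begin

text \<open>
  A quantitative form of \<open>U' = i T U\<close> for \<open>U t = exp (i t T)\<close>. The partial sum of order \<open>n + 1\<close> has the
  partial sum of order \<open>n\<close>, multiplied by \<open>i T\<close>, as its derivative, so the estimate for partial sums
  reduces to \<open>power_taylor_remainder_le\<close> for each monomial.
\<close>

lemma exp_taylor_le:
  fixes s t R :: real
  assumes T: "Vector_Spaces.linear scale scale T"
    and M: "\<And>x. nrm (T x) \<le> M * nrm x" "0 \<le> M"
    and R: "\<bar>t\<bar> \<le> R" "\<bar>s\<bar> \<le> R" "1 \<le> R"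
  defines "U \<equiv> \<lambda>t. op_exp (\<lambda>w. scale (\<i> * of_real t) (T w))"
  shows "nrm (U (t + s) z - U t z - scale (\<i> * of_real s) (T (U t z))) \<le> s\<^sup>2 * exp (4 * R * M) * nrm z"
proof -
  define S where "S = (\<lambda>n t. \<Sum>k<n. scale ((\<i> * of_real t) ^ k / fact k) ((T ^^ k) z))"
  define r where "r = (\<lambda>t n. (\<Sum>k. (\<bar>t\<bar> * M) ^ (k + n) / fact (k + n)) * nrm z)"
  have U: "nrm (U t z - S n t) \<le> r t n" for t n
  proof -
    have pow: "((\<lambda>w. scale (\<i> * of_real t) (T w)) ^^ k) z = scale ((\<i> * of_real t) ^ k) ((T ^^ k) z)" for k
      by (induction k) (simp_all add: linear_scale[OF T] mult.commute)
    have "nrm (U t z - (\<Sum>k<n. scale (1 / fact k) (((\<lambda>w. scale (\<i> * of_real t) (T w)) ^^ k) z))) \<le> r t n"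
      unfolding U_def r_def
    proof (rule op_exp_approx)
      show "Vector_Spaces.linear scale scale (\<lambda>w. scale (\<i> * of_real t) (T w))"
        using T by (intro linearI) (simp_all add: Vector_Spaces.linear_iff scale_right_distrib mult.commute)
      show "nrm (scale (\<i> * of_real t) (T x)) \<le> \<bar>t\<bar> * M * nrm x" for x
        using mult_left_mono[OF M(1)[of x] abs_ge_zero[of t]] by (simp add: nrm_scale norm_mult)
    qed (use M(2) in simp)
    then show ?thesis
      by (simp add: S_def pow)
  qed
  have r: "r t \<longlonglongrightarrow> 0" for t
  proof -
    have "summable (\<lambda>k. (\<bar>t\<bar> * M) ^ k / fact k)"
      using summable_exp[of "\<bar>t\<bar> * M"] by (simp add: divide_inverse mult.commute)
    then show ?thesis
      unfolding r_def by (intro tendsto_mult_left_zero tendsto_suminf_tail)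
  qed
  have partial: "nrm (S (Suc n) (t + s) - S (Suc n) t - scale (\<i> * of_real s) (T (S n t)))
      \<le> s\<^sup>2 * exp (4 * R * M) * nrm z" for n
  proof -
    define e where "e = (\<lambda>k. (t + s) ^ Suc k - t ^ Suc k - real (Suc k) * s * t ^ k)"
    have "scale (\<i> * of_real s) (T (S n t))
        = (\<Sum>k<n. scale (\<i> ^ Suc k * of_real (real (Suc k) * s * t ^ k) / fact (Suc k)) ((T ^^ Suc k) z))"
      unfolding S_def linear_sum[OF T] linear_scale[OF T] scale_sum_right
    proof (intro sum.cong refl)
      fix k
      have "(1 + of_nat k :: complex) \<noteq> 0"
        by (metis of_nat_Suc of_nat_neq_0)
      then have "\<i> * of_real s * ((\<i> * of_real t) ^ k / fact k)
          = \<i> ^ Suc k * of_real (real (Suc k) * s * t ^ k) / (fact (Suc k) :: complex)"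
        by (simp add: power_mult_distrib divide_simps)
      then show "scale (\<i> * of_real s) (scale ((\<i> * of_real t) ^ k / fact k) (T ((T ^^ k) z)))
          = scale (\<i> ^ Suc k * of_real (real (Suc k) * s * t ^ k) / fact (Suc k)) ((T ^^ Suc k) z)"
        by simp
    qed
    moreover have "S (Suc n) x = z + (\<Sum>k<n. scale (\<i> ^ Suc k * of_real (x ^ Suc k) / fact (Suc k)) ((T ^^ Suc k) z))"
      for x
      unfolding S_def sum.lessThan_Suc_shift by (simp add: power_mult_distrib mult_ac)
    ultimately have "S (Suc n) (t + s) - S (Suc n) t - scale (\<i> * of_real s) (T (S n t))
        = (\<Sum>k<n. scale (\<i> ^ Suc k * of_real (e k) / fact (Suc k)) ((T ^^ Suc k) z))"
      unfolding e_def of_real_diff right_diff_distrib diff_divide_distrib scale_left_diff_distrib sum_subtractf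
      by simp
    then have "nrm (S (Suc n) (t + s) - S (Suc n) t - scale (\<i> * of_real s) (T (S n t)))
        \<le> (\<Sum>k<n. nrm (scale (\<i> ^ Suc k * of_real (e k) / fact (Suc k)) ((T ^^ Suc k) z)))"
      by (simp only: nrm_sum)
    also have "\<dots> \<le> (\<Sum>k<n. s\<^sup>2 * nrm z * ((4 * R * M) ^ Suc k / fact (Suc k)))"
    proof (intro sum_mono)
      fix k
      have "nrm (scale (\<i> ^ Suc k * of_real (e k) / fact (Suc k)) ((T ^^ Suc k) z))
          = \<bar>e k\<bar> / fact (Suc k) * nrm ((T ^^ Suc k) z)"
        by (simp only: nrm_scale norm_divide norm_mult norm_power norm_ii power_one norm_of_real norm_fact mult_1)
      also have "\<dots> \<le> (s\<^sup>2 * (4 * R) ^ Suc k) / fact (Suc k) * (M ^ Suc k * nrm z)"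
        using power_taylor_remainder_le[OF R, of k] R(3) unfolding e_def
        by (intro mult_mono divide_right_mono nrm_funpow_le M) (auto simp: nrm_nonneg simp del: fact_Suc)
      finally show "nrm (scale (\<i> ^ Suc k * of_real (e k) / fact (Suc k)) ((T ^^ Suc k) z))
          \<le> s\<^sup>2 * nrm z * ((4 * R * M) ^ Suc k / fact (Suc k))"
        by (simp add: power_mult_distrib mult_ac del: fact_Suc)
    qed
    also have "\<dots> = s\<^sup>2 * nrm z * (\<Sum>k<n. (4 * R * M) ^ Suc k / fact (Suc k))"
      by (simp add: sum_distrib_left)
    also have "\<dots> \<le> s\<^sup>2 * nrm z * exp (4 * R * M)"
    proof (intro mult_left_mono mult_nonneg_nonneg nrm_nonneg zero_le_power2)
      have "(\<Sum>k<n. (4 * R * M) ^ Suc k / fact (Suc k)) \<le> (\<Sum>k<Suc n. (4 * R * M) ^ k / fact k)"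
        unfolding sum.lessThan_Suc_shift by simp
      also have "\<dots> \<le> (\<Sum>k. (4 * R * M) ^ k / fact k)"
        using R(3) M(2) summable_exp[of "4 * R * M"] by (intro sum_le_suminf) (auto simp: field_simps)
      finally show "(\<Sum>k<n. (4 * R * M) ^ Suc k / fact (Suc k)) \<le> exp (4 * R * M)"
        by (simp add: exp_def divide_inverse mult.commute)
    qed
    finally show ?thesis
      by (simp only: mult_ac)
  qed
  show ?thesis
  proof (rule LIMSEQ_le_const)
    show "(\<lambda>n. s\<^sup>2 * exp (4 * R * M) * nrm z + r (t + s) (Suc n) + r t (Suc n) + \<bar>s\<bar> * (M * r t n))
        \<longlonglongrightarrow> s\<^sup>2 * exp (4 * R * M) * nrm z"
      by (auto intro!: tendsto_eq_intros r[THEN LIMSEQ_Suc] r)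
    have "nrm (U (t + s) z - U t z - scale (\<i> * of_real s) (T (U t z)))
        \<le> s\<^sup>2 * exp (4 * R * M) * nrm z + r (t + s) (Suc n) + r t (Suc n) + \<bar>s\<bar> * (M * r t n)" for n
    proof -
      let ?A = "U (t + s) z - S (Suc n) (t + s)" and ?B = "U t z - S (Suc n) t"
        and ?C = "scale (\<i> * of_real s) (T (U t z - S n t))"
        and ?P = "S (Suc n) (t + s) - S (Suc n) t - scale (\<i> * of_real s) (T (S n t))"
      have eq: "U (t + s) z - U t z - scale (\<i> * of_real s) (T (U t z)) = ?P + ?A - ?B - ?C"
        by (simp add: linear_diff[OF T] scale_right_diff_distrib)
      have "nrm ?C \<le> \<bar>s\<bar> * (M * r t n)"
        using mult_left_mono[OF order_trans[OF M(1) mult_left_mono[OF U[of t n] M(2)]] abs_ge_zero[of s]]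
        by (simp add: nrm_scale norm_mult)
      then show ?thesis
        unfolding eq
        using nrm_triangle_diff[of "?P + ?A - ?B" ?C] nrm_triangle_diff[of "?P + ?A" ?B]
          nrm_triangle[of ?P ?A] U[of "t + s" "Suc n"] U[of t "Suc n"] partial[of n]
        by linarith
    qed
    then show "\<exists>N. \<forall>n\<ge>N. nrm (U (t + s) z - U t z - scale (\<i> * of_real s) (T (U t z)))
        \<le> s\<^sup>2 * exp (4 * R * M) * nrm z + r (t + s) (Suc n) + r t (Suc n) + \<bar>s\<bar> * (M * r t n)"
      by blast
  qed
qed

text \<open>
  To first order \<open>exp (i (t + s) T) z\<close> is \<open>(1 + i s T) (exp (i t T) z)\<close>, and by hypothesis this factor
  increases the norm only to second order in \<open>s\<close>.
\<close>

lemma hermitian_op_if_imaginary_step: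
  assumes T: "Vector_Spaces.linear scale scale T"
    and M: "\<And>x. nrm (T x) \<le> M * nrm x" "0 \<le> M"
    and step: "\<And>s x. nrm (x + scale (\<i> * of_real s) (T x)) \<le> (1 + C * s\<^sup>2) * nrm x" and "0 \<le> C"
  shows "hermitian_op T"
  unfolding hermitian_op_def
proof (intro allI)
  fix t :: real and z
  define U where "U = (\<lambda>t. op_exp (\<lambda>w. scale (\<i> * of_real t) (T w)) z)"
  have U0: "U 0 = z"
  proof -
    have "nrm (op_exp (\<lambda>w. scale (\<i> * of_real 0) (T w)) z
        - (\<Sum>k<1. scale (1 / fact k) (((\<lambda>w. scale (\<i> * of_real 0) (T w)) ^^ k) z)))
        \<le> (\<Sum>k. (0::real) ^ (k + 1) / fact (k + 1)) * nrm z"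
      by (rule op_exp_approx) (auto intro!: linearI)
    then have "nrm (U 0 - z) \<le> 0" by (simp add: U_def)
    then show ?thesis using nrm_nonneg[of "U 0 - z"] by (simp add: nrm_eq_0)
  qed
  have "nrm (U t) = nrm (U 0)"
  proof (rule constant_if_quadratic_increments)
    fix R :: real assume R: "1 \<le> R"
    define D where "D = exp (4 * R * M) * nrm z"
    have D: "0 \<le> D" by (simp add: D_def nrm_nonneg)
    have taylor: "nrm (U (t + s) - U t - scale (\<i> * of_real s) (T (U t))) \<le> D * s\<^sup>2"
      if "\<bar>t\<bar> \<le> R" "\<bar>s\<bar> \<le> R" for t s
      using exp_taylor_le[OF T M that R, of z] by (simp add: U_def D_def mult_ac)
    have U_bound: "nrm (U t) \<le> nrm z + R * (M * nrm z) + D * R\<^sup>2" if "\<bar>t\<bar> \<le> R" for t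
    proof -
      have "nrm (U t - z - scale (\<i> * of_real t) (T z)) \<le> D * t\<^sup>2"
        using taylor[of 0 t] that R by (simp add: U0)
      moreover have "D * t\<^sup>2 \<le> D * R\<^sup>2"
        using D that by (intro mult_left_mono) (simp_all add: abs_le_square_iff[symmetric])
      moreover have "nrm (scale (\<i> * of_real t) (T z)) \<le> R * (M * nrm z)"
        using mult_mono[OF that M(1)[of z]] R by (simp add: nrm_scale norm_mult nrm_nonneg)
      ultimately show ?thesis
        using nrm_triangle[of "U t - z - scale (\<i> * of_real t) (T z)" "z + scale (\<i> * of_real t) (T z)"]
          nrm_triangle[of z "scale (\<i> * of_real t) (T z)"] by simp
    qed
    define B where "B = nrm z + R * (M * nrm z) + D * R\<^sup>2"
    have "nrm (U (t + s)) \<le> nrm (U t) + (C * B + D) * s\<^sup>2" if "\<bar>t\<bar> \<le> R" "\<bar>s\<bar> \<le> R" for t s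
    proof -
      have "nrm (U (t + s)) \<le> (1 + C * s\<^sup>2) * nrm (U t) + D * s\<^sup>2"
        using nrm_triangle[of "U (t + s) - U t - scale (\<i> * of_real s) (T (U t))"
            "U t + scale (\<i> * of_real s) (T (U t))"] taylor[OF that] step[of "U t" s]
        by simp
      moreover have "C * s\<^sup>2 * nrm (U t) \<le> C * s\<^sup>2 * B"
        using U_bound[OF that(1)] \<open>0 \<le> C\<close> unfolding B_def by (intro mult_left_mono) auto
      ultimately show ?thesis by (simp add: algebra_simps)
    qed
    then show "\<exists>D. \<forall>t s. \<bar>t\<bar> \<le> R \<longrightarrow> \<bar>s\<bar> \<le> R \<longrightarrow> nrm (U (t + s)) \<le> nrm (U t) + D * s\<^sup>2"
      by blast
  qed
  then show "nrm (op_exp (\<lambda>w. scale (\<i> * of_real t) (T w)) z) = nrm z"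
    using U0 by (simp add: U_def)
qed

text \<open>
  With \<open>N = 1 + \<sigma> T\<close> and \<open>l = 1 + \<sigma> \<mu>\<close> one has \<open>\<sigma> (T - \<mu>) = N - l\<close>, which a Neumann series inverts because
  \<open>\<parallel>N\<parallel> \<le> q < \<bar>l\<bar>\<close>.
\<close>

lemma not_in_op_spectrum:
  assumes T: "Vector_Spaces.linear scale scale T"
    and q: "\<And>x. nrm (x + scale \<sigma> (T x)) \<le> q * nrm x" "0 \<le> q"
    and \<mu>: "q < cmod (1 + \<sigma> * \<mu>)" and "\<sigma> \<noteq> 0"
  shows "\<mu> \<notin> op_spectrum T"
proof -
  define N where "N = (\<lambda>x. x + scale \<sigma> (T x))"
  define l where "l = 1 + \<sigma> * \<mu>"
  define w where "w = 1 / l"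
  have l: "l \<noteq> 0" using \<mu> q(2) by (auto simp: l_def)
  have N_lin: "Vector_Spaces.linear scale scale N"
    using T unfolding N_def
    by (intro linearI) (simp_all add: Vector_Spaces.linear_iff scale_right_distrib mult.commute)
  have N_le: "nrm (N x) \<le> q * nrm x" for x
    using q(1) by (simp add: N_def)
  have ratio: "0 \<le> cmod w * q" "cmod w * q < 1"
    using \<mu> q(2) l unfolding w_def l_def[symmetric] by (simp_all add: norm_divide divide_less_eq)
  have summable: "summable (\<lambda>k. cmod (w ^ k) * q ^ k)"
    using ratio by (simp add: norm_power summable_geometric flip: power_mult_distrib)
  obtain P where P: "Vector_Spaces.linear scale scale P"
    "\<And>n z. nrm (P z - (\<Sum>k<n. scale (w ^ k) ((N ^^ k) z)))
             \<le> (\<Sum>k. cmod (w ^ (k + n)) * q ^ (k + n)) * nrm z"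
    "\<And>z. P (N z) = N (P z)"
    by (rule power_series_operator[OF N_lin N_le q(2) summable]) (rule that)
  define r where "r = (\<lambda>n. \<Sum>k. cmod (w ^ (k + n)) * q ^ (k + n))"
  have r: "r \<longlonglongrightarrow> 0"
    unfolding r_def by (rule tendsto_suminf_tail[OF summable])
  have inv: "P z - scale w (N (P z)) = z" for z
  proof (rule eq_if_nrm_diff_tendsto_0)
    show "(\<lambda>n. r n * nrm z + cmod w * (q * (r n * nrm z)) + (cmod w * q) ^ n * nrm z) \<longlonglongrightarrow> 0"
      using ratio by (auto intro!: tendsto_eq_intros r LIMSEQ_power_zero)
    fix n
    define G where "G = (\<Sum>k<n. scale (w ^ k) ((N ^^ k) z))"
    have G: "nrm (P z - G) \<le> r n * nrm z"
      unfolding G_def r_def by (rule P(2))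
    have tel: "G - scale w (N G) = z - scale (w ^ n) ((N ^^ n) z)"
      unfolding G_def by (rule geometric_sum_telescope[OF N_lin])
    have eq: "P z - scale w (N (P z)) - z = (P z - G) - scale w (N (P z - G)) - scale (w ^ n) ((N ^^ n) z)"
      using tel by (simp add: linear_diff[OF N_lin] scale_right_diff_distrib algebra_simps)
    have "nrm (scale w (N (P z - G))) \<le> cmod w * (q * (r n * nrm z))"
      using mult_left_mono[OF order_trans[OF N_le mult_left_mono[OF G q(2)]] norm_ge_zero[of w]]
      by (simp add: nrm_scale)
    moreover have "nrm (scale (w ^ n) ((N ^^ n) z)) \<le> (cmod w * q) ^ n * nrm z"
      using mult_left_mono[OF nrm_funpow_le[OF N_le q(2), where n = n and x = z], of "cmod (w ^ n)"]
      by (simp add: nrm_scale norm_power power_mult_distrib mult.assoc)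
    ultimately show "nrm (P z - scale w (N (P z)) - z)
        \<le> r n * nrm z + cmod w * (q * (r n * nrm z)) + (cmod w * q) ^ n * nrm z"
      unfolding eq
      using G nrm_triangle_diff[of "(P z - G) - scale w (N (P z - G))" "scale (w ^ n) ((N ^^ n) z)"]
        nrm_triangle_diff[of "P z - G" "scale w (N (P z - G))"] by linarith
  qed
  define S where "S = (\<lambda>y. scale (- (\<sigma> / l)) (P y))"
  have shift: "T z - scale \<mu> z = scale (- (l / \<sigma>)) (z - scale w (N z))" for z
  proof -
    have "z - scale w (N z) = scale w (scale l z - N z)"
      using l by (simp add: w_def scale_right_diff_distrib)
    also have "scale l z - N z = scale (- \<sigma>) (T z - scale \<mu> z)"
      by (simp add: l_def N_def scale_left_distrib scale_right_diff_distrib)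
    finally show ?thesis
      using l \<open>\<sigma> \<noteq> 0\<close> by (simp add: w_def)
  qed
  have "bounded_op S"
    unfolding bounded_op_def
  proof
    show "Vector_Spaces.linear scale scale S"
      using P(1) unfolding S_def
      by (intro linearI) (simp_all add: Vector_Spaces.linear_iff scale_right_distrib mult.commute)
    have "nrm (S z) \<le> cmod (\<sigma> / l) * r 0 * nrm z" for z
      using mult_left_mono[OF P(2)[of z 0] norm_ge_zero[of "\<sigma> / l"]]
      by (simp add: S_def nrm_scale nrm_minus r_def mult.assoc)
    then show "\<exists>K. \<forall>z. nrm (S z) \<le> K * nrm z" by blast
  qed
  moreover have "S (T z - scale \<mu> z) = z" for z
  proof -
    have "S (T z - scale \<mu> z) = P (z - scale w (N z))"
      unfolding shift S_def linear_scale[OF P(1)] using l \<open>\<sigma> \<noteq> 0\<close> by simp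
    also have "\<dots> = P z - scale w (N (P z))"
      by (simp add: linear_diff[OF P(1)] linear_scale[OF P(1)] P(3))
    finally show ?thesis by (simp add: inv)
  qed
  moreover have "T (S z) - scale \<mu> (S z) = z" for z
  proof -
    have "S z - scale w (N (S z)) = scale (- (\<sigma> / l)) (P z - scale w (N (P z)))"
      unfolding S_def linear_scale[OF N_lin] by (simp add: scale_right_diff_distrib mult.commute)
    then show ?thesis
      unfolding shift inv using l \<open>\<sigma> \<noteq> 0\<close> by simp
  qed
  ultimately show ?thesis
    unfolding op_spectrum_def by blast
qed

text \<open>
  Non-real \<open>\<mu>\<close> are excluded by \<open>\<sigma> = i s\<close> with small \<open>s\<close> in \<open>not_in_op_spectrum\<close>, and negative \<open>\<mu>\<close> by
  \<open>\<sigma> = - 1 / t\<close>.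
\<close>

lemma op_spectrum_nonneg:
  assumes T: "Vector_Spaces.linear scale scale T"
    and step: "\<And>s x. nrm (x + scale (\<i> * of_real s) (T x)) \<le> (1 + C * s\<^sup>2) * nrm x" and "0 \<le> C"
    and contr: "\<And>x. nrm (scale (of_real t) x - T x) \<le> t * nrm x" and "0 < t"
  shows "op_spectrum T \<subseteq> \<real>\<^sub>\<ge>\<^sub>0"
proof
  fix \<mu> assume \<mu>: "\<mu> \<in> op_spectrum T"
  have "Im \<mu> = 0"
  proof (rule ccontr)
    assume im: "Im \<mu> \<noteq> 0"
    \<comment> \<open>The step length \<open>s\<close> is chosen such that \<open>C * s\<^sup>2 < \<bar>s * Im \<mu>\<bar> = - s * Im \<mu>\<close>.\<close>
    define s where "s = - Im \<mu> / (C + 1)"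
    have "s \<noteq> 0" using im \<open>0 \<le> C\<close> by (simp add: s_def)
    have "C * s\<^sup>2 < (C + 1) * s\<^sup>2"
      using \<open>s \<noteq> 0\<close> by simp
    also have "\<dots> = - (s * Im \<mu>)"
      using \<open>0 \<le> C\<close> by (simp add: s_def power2_eq_square)
    also have "1 + \<dots> \<le> cmod (1 + (\<i> * of_real s) * \<mu>)"
      using abs_Re_le_cmod[of "1 + (\<i> * of_real s) * \<mu>"] by simp
    finally have "1 + C * s\<^sup>2 < cmod (1 + (\<i> * of_real s) * \<mu>)"
      by simp
    then have "\<mu> \<notin> op_spectrum T"
      using \<open>s \<noteq> 0\<close> \<open>0 \<le> C\<close> by (intro not_in_op_spectrum[OF T step]) auto
    with \<mu> show False by simp
  qed
  moreover have "0 \<le> Re \<mu>"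
  proof (rule ccontr)
    assume re: "\<not> 0 \<le> Re \<mu>"
    have scaled: "nrm (x + scale (of_real (- 1 / t)) (T x)) \<le> 1 * nrm x" for x
    proof -
      have "x + scale (of_real (- 1 / t)) (T x) = scale (of_real (1 / t)) (scale (of_real t) x - T x)"
        using \<open>0 < t\<close> by (simp add: scale_right_diff_distrib)
      then show ?thesis
        using contr[of x] \<open>0 < t\<close> by (simp add: nrm_scale norm_divide divide_le_eq mult.commute)
    qed
    have far: "1 < cmod (1 + of_real (- 1 / t) * \<mu>)"
    proof -
      have "Re (1 + of_real (- 1 / t) * \<mu>) = 1 - Re \<mu> / t"
        by simp
      moreover have "Re \<mu> / t < 0"
        using re \<open>0 < t\<close> by (simp add: divide_neg_pos)
      ultimately show ?thesis
        using complex_Re_le_cmod[of "1 + of_real (- 1 / t) * \<mu>"] by linarith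
    qed
    have "\<mu> \<notin> op_spectrum T"
      by (rule not_in_op_spectrum[OF T scaled _ far]) (use \<open>0 < t\<close> in auto)
    with \<mu> show False by simp
  qed
  ultimately show "\<mu> \<in> \<real>\<^sub>\<ge>\<^sub>0"
    by (simp add: complex_nonneg_Reals_iff)
qed

end

section \<open>The triple product\<close>

context inner_product_module
begin

interpretation normed: complex_normed_space scaleE nrm
  by (rule complex_normed_space)

interpretation form: c_star_form scaleA star scaleE nrm ip
  by (rule c_star_form)

interpretation self: c_star_form scaleA star scaleA norm "\<lambda>a b. star a * b"
  by (rule A.c_star_form)

lemma linear_left_rank_one: "Vector_Spaces.linear scaleE scaleE (\<lambda>z. act a (ip b z))"
  by (rule normed.linearI)
     (simp_all add: ip_add_right ip_scale_right act_add_right scaleE_act_right[symmetric])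

lemma symmetric_rank_one: "form.symmetric (\<lambda>z. act a (ip a z))"
  unfolding form.symmetric_def
  by (simp add: linear_left_rank_one inner_act ip_act_left inner_star[symmetric])

lemma nrm_rank_one_le: "nrm (act a (ip b z)) \<le> nrm a * nrm b * nrm z"
  using nrm_act_le[of a "ip b z"] mult_left_mono[OF cauchy_schwarz[of b z] module_norm_nonneg[of a]]
  by (simp add: mult.assoc)

text \<open>
  Since \<open>\<langle>a, a.\<langle>a, z\<rangle>\<rangle> = \<langle>a, a\<rangle> \<langle>a, z\<rangle>\<close>, applying \<open>\<langle>a, _\<rangle>\<close> to \<open>y = r z + a.\<langle>a, z\<rangle>\<close> gives \<open>(r + \<langle>a, a\<rangle>) \<langle>a, z\<rangle>\<close>.
  The positivity of \<open>\<langle>a, a\<rangle>\<close> thus controls \<open>\<langle>a, z\<rangle>\<close> by \<open>y\<close>, and then \<open>r z = y - a.\<langle>a, z\<rangle>\<close> as well.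
\<close>

lemma rank_one_below:
  assumes "0 < r"
  shows "\<exists>\<delta>>0. \<forall>z. \<delta> * nrm z \<le> nrm (scaleE (of_real r) z + act a (ip a z))"
proof -
  obtain d where d: "0 < d" "\<And>b. d * norm b \<le> norm (r *\<^sub>R b + ip a a * b)"
    using A.positive_resolvent_below[OF inner_positive[of a] assms] by blast
  define C where "C = 1 + nrm a * (nrm a / d)"
  have "0 < C"
    using d(1) module_norm_nonneg[of a] by (simp add: C_def add_pos_nonneg)
  have "r * nrm z \<le> C * nrm (scaleE (of_real r) z + act a (ip a z))" for z
  proof -
    let ?y = "scaleE (of_real r) z + act a (ip a z)"
    have "ip a ?y = r *\<^sub>R ip a z + ip a a * ip a z"
      by (simp add: ip_add_right ip_scale_right inner_act A.scaleC_of_real)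
    then have "d * norm (ip a z) \<le> nrm a * nrm ?y"
      using d(2)[of "ip a z"] cauchy_schwarz[of a ?y] by simp
    then have "norm (ip a z) \<le> nrm a / d * nrm ?y"
      using d(1) by (simp add: field_simps)
    then have "nrm (act a (ip a z)) \<le> nrm a * (nrm a / d * nrm ?y)"
      using nrm_act_le[of a "ip a z"] mult_left_mono[OF _ module_norm_nonneg[of a]]
      by (meson order_trans)
    moreover have "r * nrm z = nrm (scaleE (of_real r) z)"
      using assms by (simp add: nrm_scaleE)
    moreover have "nrm (scaleE (of_real r) z) \<le> nrm ?y + nrm (act a (ip a z))"
      using normed.nrm_triangle_diff[of ?y "act a (ip a z)"] by simp
    ultimately show ?thesis
      by (simp add: C_def distrib_right mult.assoc)
  qed
  then show ?thesis
    using \<open>0 < C\<close> assms by (intro exI[of _ "r / C"]) (simp add: field_simps)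
qed

lemma rank_one_contraction:
  assumes "(nrm a)\<^sup>2 \<le> t"
  shows "nrm (scaleE (of_real t) z - act a (ip a z)) \<le> t * nrm z"
  using form.symmetric_contraction[OF symmetric_rank_one, of a "(nrm a)\<^sup>2" t] nrm_rank_one_le[of a a]
    rank_one_below[of _ a] assms
  by (simp add: power2_eq_square)

lemma rank_one_imaginary_step:
  "nrm (z + scaleE (\<i> * of_real s) (act a (ip a z))) \<le> (1 + ((nrm a)\<^sup>2)\<^sup>2 * s\<^sup>2) * nrm z"
  using form.symmetric_imaginary_step[OF symmetric_rank_one, of a "(nrm a)\<^sup>2"] nrm_rank_one_le[of a a]
  by (simp add: power2_eq_square)

text \<open>
  The inner square of \<open>t z - z.h\<close> is \<open>(t - h) \<langle>z, z\<rangle> (t - h)\<close>, and multiplication by \<open>t - h\<close> from either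
  side has norm at most \<open>t\<close> on the algebra.
\<close>

lemma right_mult_contraction:
  assumes h: "A.positive h" and t: "norm h \<le> t"
  shows "nrm (scaleE (of_real t) z - act z h) \<le> t * nrm z"
proof (rule power2_le_imp_le)
  have "0 \<le> t" using t norm_ge_zero[of h] by linarith
  define d where "d = t *\<^sub>R ip z z - ip z z * h"
  have "ip (scaleE (of_real t) z - act z h) (scaleE (of_real t) z - act z h) = t *\<^sub>R d - h * d"
    by (simp add: d_def ip_diff_left ip_diff_right ip_scale_left ip_scale_right inner_act ip_act_left
        A.positive_star[OF h] A.scaleC_of_real scaleR_diff_right left_diff_distrib right_diff_distrib
        mult.assoc)
  then have "(nrm (scaleE (of_real t) z - act z h))\<^sup>2 = norm (t *\<^sub>R d - h * d)"
    by (simp add: nrm_square)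
  also have "\<dots> \<le> t * norm d"
    by (rule A.positive_contraction[OF h t])
  also have "\<dots> \<le> t * (t * norm (ip z z))"
    unfolding d_def by (intro mult_left_mono A.positive_contraction_right[OF h t] \<open>0 \<le> t\<close>)
  finally show "(nrm (scaleE (of_real t) z - act z h))\<^sup>2 \<le> (t * nrm z)\<^sup>2"
    by (simp add: power_mult_distrib nrm_square power2_eq_square[of t] mult.assoc)
  show "0 \<le> t * nrm z"
    using \<open>0 \<le> t\<close> module_norm_nonneg by simp
qed

text \<open>
  Multiplication by \<open>h\<close> from the right is in general not symmetric for the inner product, but the
  inner square of \<open>z + i s z.h\<close> is \<open>(1 - i s h) \<langle>z, z\<rangle> (1 + i s h)\<close>, and multiplication by \<open>h\<close> on the
  algebra is symmetric.
\<close>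

lemma right_mult_imaginary_step:
  assumes h: "star h = h"
  shows "nrm (z + scaleE (\<i> * of_real s) (act z h)) \<le> (1 + (norm h)\<^sup>2 * s\<^sup>2) * nrm z"
proof (rule power2_le_imp_le)
  let ?q = "1 + (norm h)\<^sup>2 * s\<^sup>2"
  have step: "norm (x + scaleA (\<i> * of_real r) (h * x)) \<le> (1 + (norm h)\<^sup>2 * r\<^sup>2) * norm x" for r x
    using self.symmetric_imaginary_step[OF A.symmetric_left_mult[OF h], of "norm h" x r] norm_mult_ineq[of h]
    by simp
  define c where "c = ip z z"
  define d where "d = c + scaleA (\<i> * of_real s) (c * h)"
  have "ip (z + scaleE (\<i> * of_real s) (act z h)) (z + scaleE (\<i> * of_real s) (act z h))
      = d + scaleA (\<i> * of_real (- s)) (h * d)"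
    by (simp add: c_def d_def ip_add_left ip_add_right ip_scale_left ip_scale_right inner_act
        ip_act_left h A.scaleC_mult_left A.scaleC_mult_right distrib_left distrib_right left_diff_distrib A.scale_right_distrib
        A.scale_right_diff_distrib mult.assoc)
  then have "(nrm (z + scaleE (\<i> * of_real s) (act z h)))\<^sup>2 = norm (d + scaleA (\<i> * of_real (- s)) (h * d))"
    by (simp only: nrm_square)
  also have "\<dots> \<le> ?q * norm d"
    using step[of d "- s"] by (simp only: power2_minus)
  also have "norm d = norm (c + scaleA (\<i> * of_real (- s)) (h * c))"
  proof -
    have "star d = c + scaleA (\<i> * of_real (- s)) (h * c)"
      by (simp add: d_def c_def A.star_add A.star_scaleC A.star_mult star_ip_self h)
    then show ?thesis by (metis A.norm_star)
  qed
  also have "?q * norm (c + scaleA (\<i> * of_real (- s)) (h * c)) \<le> ?q * (?q * norm c)"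
    using step[of c "- s"] by (intro mult_left_mono) (simp_all only: power2_minus, simp)
  finally show "(nrm (z + scaleE (\<i> * of_real s) (act z h)))\<^sup>2 \<le> (?q * nrm z)\<^sup>2"
    by (simp add: c_def power_mult_distrib nrm_square power2_eq_square[of ?q] mult.assoc)
qed (simp add: module_norm_nonneg)

definition module_triple :: "'e \<Rightarrow> 'e \<Rightarrow> 'e \<Rightarrow> 'e" where
  "module_triple x y z = scaleE (1/2) (act x (ip y z) + act z (ip y x))"

lemma module_triple_add:
  "module_triple (x + x') y z = module_triple x y z + module_triple x' y z"
  "module_triple x (y + y') z = module_triple x y z + module_triple x y' z"
  "module_triple x y (z + z') = module_triple x y z + module_triple x y z'"
  by (simp_all add: module_triple_def act_add_left act_add_right ip_add_left ip_add_right
      E.scale_right_distrib add_ac)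

lemma module_triple_scale:
  "module_triple (scaleE \<alpha> x) y z = scaleE \<alpha> (module_triple x y z)"
  "module_triple x (scaleE \<alpha> y) z = scaleE (cnj \<alpha>) (module_triple x y z)"
  "module_triple x y (scaleE \<alpha> z) = scaleE \<alpha> (module_triple x y z)"
  by (simp_all add: module_triple_def ip_scale_left ip_scale_right scaleE_act_left[symmetric]
      scaleE_act_right[symmetric] E.scale_right_distrib mult.commute)

lemma module_triple_jordan:
  "module_triple a b (module_triple c d z) - module_triple c d (module_triple a b z)
     = module_triple (module_triple a b c) d z - module_triple c (module_triple d a b) z"
  by (simp add: module_triple_def act_add_left act_add_right act_mult[symmetric] inner_act ip_act_left
      inner_star[symmetric] scaleE_act_left[symmetric] scaleE_act_right[symmetric]
      ip_add_left ip_add_right ip_scale_left ip_scale_right A.scaleC_mult_left A.scaleC_mult_right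
      A.scale_right_distrib E.scale_right_distrib distrib_left distrib_right mult.assoc)

lemma module_triple_bound: "nrm (module_triple x y z) \<le> nrm x * nrm y * nrm z"
proof -
  have "nrm (act x (ip y z) + act z (ip y x)) \<le> 2 * (nrm x * nrm y * nrm z)"
    using module_norm_triangle[of "act x (ip y z)" "act z (ip y x)"]
      nrm_rank_one_le[of x y z] nrm_rank_one_le[of z y x] by (simp add: mult_ac)
  then show ?thesis
    by (simp add: module_triple_def nrm_scaleE norm_divide)
qed

lemma module_triple_imaginary_step:
  "nrm (z + scaleE (\<i> * of_real s) (module_triple a a z)) \<le> (1 + ((nrm a)\<^sup>2)\<^sup>2 * s\<^sup>2) * nrm z"
proof -
  let ?l = "z + scaleE (\<i> * of_real s) (act a (ip a z))" and ?r = "z + scaleE (\<i> * of_real s) (act z (ip a a))"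
  have "z + scaleE (\<i> * of_real s) (module_triple a a z) = scaleE (1/2) (?l + ?r)"
    by (simp add: module_triple_def E.scale_right_distrib mult.commute add_ac flip: E.scale_left_distrib)
  then have "nrm (z + scaleE (\<i> * of_real s) (module_triple a a z)) = nrm (?l + ?r) / 2"
    by (simp add: nrm_scaleE norm_divide)
  then show ?thesis
    using module_norm_triangle[of ?l ?r] rank_one_imaginary_step[of z s a]
      right_mult_imaginary_step[OF star_ip_self, of z s a]
    by (simp add: nrm_square)
qed

lemma module_triple_contraction:
  assumes "(nrm a)\<^sup>2 \<le> t"
  shows "nrm (scaleE (of_real t) z - module_triple a a z) \<le> t * nrm z"
proof -
  let ?l = "scaleE (of_real t) z - act a (ip a z)" and ?r = "scaleE (of_real t) z - act z (ip a a)"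
  have "scaleE (of_real t) z - module_triple a a z = scaleE (1/2) (?l + ?r)"
    by (simp add: module_triple_def E.scale_right_distrib E.scale_right_diff_distrib
        flip: E.scale_left_distrib)
  then have "nrm (scaleE (of_real t) z - module_triple a a z) = nrm (?l + ?r) / 2"
    by (simp add: nrm_scaleE norm_divide)
  then show ?thesis
    using module_norm_triangle[of ?l ?r] rank_one_contraction[OF assms, of z]
      right_mult_contraction[OF inner_positive, of a t z] assms
    by (simp add: nrm_square)
qed

lemma nrm_module_triple_diagonal: "nrm (module_triple a a a) = nrm a ^ 3"
proof -
  define h where "h = ip a a"
  have h: "star h = h" by (simp add: h_def star_ip_self)
  have sq: "norm (h * h) = (norm h)\<^sup>2"
    using A.c_star_identity[of h] by (simp add: h)
  have cube: "norm (h * h * h) = norm h ^ 3"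
  proof (rule antisym)
    have "norm (h * h * h) \<le> norm (h * h) * norm h" by (rule norm_mult_ineq)
    then show "norm (h * h * h) \<le> norm h ^ 3"
      by (simp add: sq power2_eq_square power3_eq_cube)
    have "norm h * norm h ^ 3 = norm (star (h * h) * (h * h))"
      by (simp only: A.c_star_identity sq) (simp add: power2_eq_square power3_eq_cube)
    also have "\<dots> \<le> norm h * norm (h * h * h)"
      using norm_mult_ineq[of h "h * h * h"] by (simp add: A.star_mult h mult.assoc)
    finally show "norm h ^ 3 \<le> norm (h * h * h)"
      by (cases "h = 0") (auto simp: mult_le_cancel_left)
  qed
  have "module_triple a a a = act a h"
    by (simp add: module_triple_def h_def flip: E.scale_left_distrib E.scale_right_distrib)
       (simp add: E.scale_right_distrib flip: E.scale_left_distrib)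
  then have "nrm (module_triple a a a) = sqrt (norm (h * h * h))"
    by (simp add: module_norm_def inner_act ip_act_left h h_def[symmetric] mult.assoc)
  then show ?thesis
    unfolding cube by (simp add: real_sqrt_power module_norm_def h_def)
qed

text \<open>
  Replacing the arguments one at a time leaves three terms, each with one factor of norm at most \<open>\<delta>\<close>.
\<close>

lemma module_triple_diff_le:
  assumes "nrm (x - a) \<le> \<delta>" "nrm (y - b) \<le> \<delta>" "nrm (z - c) \<le> \<delta>" "\<delta> \<le> 1"
  shows "nrm (module_triple x y z - module_triple a b c) \<le> 3 * \<delta> * (nrm a + nrm b + nrm c + 1)\<^sup>2"
proof -
  define B where "B = nrm a + nrm b + nrm c + 1"
  note pos = module_norm_nonneg
  have abc: "nrm a \<le> B" "nrm b \<le> B" "nrm c \<le> B"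
    using pos[of a] pos[of b] pos[of c] by (simp_all add: B_def)
  have yz: "nrm y \<le> B" "nrm z \<le> B"
    using module_norm_triangle[of "y - b" b] module_norm_triangle[of "z - c" c] assms
      pos[of a] pos[of b] pos[of c] by (simp_all add: B_def)
  have "0 \<le> B" "0 \<le> \<delta>"
    using abc(1) assms(1) pos[of a] pos[of "x - a"] by linarith+
  have bound: "nrm (module_triple u v w) \<le> \<delta> * B\<^sup>2"
    if "nrm u * nrm v * nrm w \<le> \<delta> * (B * B)" for u v w
    using module_triple_bound[of u v w] that by (simp add: power2_eq_square)
  have tele: "module_triple x y z - module_triple a b c
      = module_triple (x - a) y z + module_triple a (y - b) z + module_triple a b (z - c)"
    using module_triple_add(1)[of "x - a" a y z] module_triple_add(2)[of a "y - b" b z]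
      module_triple_add(3)[of a b "z - c" c] by simp
  have "nrm (module_triple (x - a) y z) \<le> \<delta> * B\<^sup>2"
  proof (rule bound)
    have "nrm (x - a) * (nrm y * nrm z) \<le> \<delta> * (B * B)"
      using assms yz \<open>0 \<le> B\<close> \<open>0 \<le> \<delta>\<close> pos by (intro mult_mono) auto
    then show "nrm (x - a) * nrm y * nrm z \<le> \<delta> * (B * B)" by (simp add: mult_ac)
  qed
  moreover have "nrm (module_triple a (y - b) z) \<le> \<delta> * B\<^sup>2"
  proof (rule bound)
    have "nrm (y - b) * (nrm a * nrm z) \<le> \<delta> * (B * B)"
      using assms yz abc \<open>0 \<le> B\<close> \<open>0 \<le> \<delta>\<close> pos by (intro mult_mono) auto
    then show "nrm a * nrm (y - b) * nrm z \<le> \<delta> * (B * B)" by (simp add: mult_ac)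
  qed
  moreover have "nrm (module_triple a b (z - c)) \<le> \<delta> * B\<^sup>2"
  proof (rule bound)
    have "nrm (z - c) * (nrm a * nrm b) \<le> \<delta> * (B * B)"
      using assms abc \<open>0 \<le> B\<close> \<open>0 \<le> \<delta>\<close> pos by (intro mult_mono) auto
    then show "nrm a * nrm b * nrm (z - c) \<le> \<delta> * (B * B)" by (simp add: mult_ac)
  qed
  ultimately show ?thesis
    unfolding tele B_def[symmetric]
    using module_norm_triangle[of "module_triple (x - a) y z + module_triple a (y - b) z" "module_triple a b (z - c)"]
      module_norm_triangle[of "module_triple (x - a) y z" "module_triple a (y - b) z"]
    by linarith
qed

lemma module_triple_continuous:
  "continuous_map
     (prod_topology normed.metric.mtopology (prod_topology normed.metric.mtopology normed.metric.mtopology))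
     normed.metric.mtopology (\<lambda>(a, b, c). module_triple a b c)"
  unfolding normed.metric.continuous_map_to_metric
proof (intro ballI allI impI)
  fix p :: "'e \<times> 'e \<times> 'e" and \<epsilon> :: real
  assume "0 < \<epsilon>"
  obtain a b c where p: "p = (a, b, c)" by (cases p)
  define B where "B = nrm a + nrm b + nrm c + 1"
  have "1 \<le> B" by (simp add: B_def module_norm_nonneg)
  define \<delta> where "\<delta> = min 1 (\<epsilon> / (4 * B\<^sup>2))"
  have "0 < \<delta>" "\<delta> \<le> 1" using \<open>0 < \<epsilon>\<close> \<open>1 \<le> B\<close> by (auto simp: \<delta>_def)
  have "3 * \<delta> * B\<^sup>2 \<le> 3 * (\<epsilon> / (4 * B\<^sup>2)) * B\<^sup>2"
    by (intro mult_right_mono mult_left_mono) (auto simp: \<delta>_def)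
  also have "\<dots> < \<epsilon>" using \<open>0 < \<epsilon>\<close> \<open>1 \<le> B\<close> by simp
  finally have small: "3 * \<delta> * B\<^sup>2 < \<epsilon>" .
  let ?ball = "\<lambda>x. normed.metric.mball x \<delta>"
  let ?U = "?ball a \<times> (?ball b \<times> ?ball c)"
  have near: "\<forall>q\<in>?U. (\<lambda>(a, b, c). module_triple a b c) q
                \<in> normed.metric.mball ((\<lambda>(a, b, c). module_triple a b c) p) \<epsilon>"
    unfolding p
  proof clarsimp
    fix x y z assume "nrm (a - x) < \<delta>" "nrm (b - y) < \<delta>" "nrm (c - z) < \<delta>"
    then have "nrm (x - a) \<le> \<delta>" "nrm (y - b) \<le> \<delta>" "nrm (z - c) \<le> \<delta>"
      using normed.nrm_minus[of "a - x"] normed.nrm_minus[of "b - y"] normed.nrm_minus[of "c - z"] by simp_all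
    then have "nrm (module_triple x y z - module_triple a b c) \<le> 3 * \<delta> * B\<^sup>2"
      unfolding B_def using \<open>\<delta> \<le> 1\<close> by (rule module_triple_diff_le)
    then show "nrm (module_triple a b c - module_triple x y z) < \<epsilon>"
      using small normed.nrm_minus[of "module_triple a b c - module_triple x y z"] by simp
  qed
  have "openin (prod_topology normed.metric.mtopology
      (prod_topology normed.metric.mtopology normed.metric.mtopology)) ?U"
    by (simp add: openin_prod_Times_iff)
  moreover have "p \<in> ?U" using \<open>0 < \<delta>\<close> by (simp add: p)
  ultimately show "\<exists>U. openin (prod_topology normed.metric.mtopology
      (prod_topology normed.metric.mtopology normed.metric.mtopology)) U \<and> p \<in> U \<and>
      (\<forall>q\<in>U. (\<lambda>(a, b, c). module_triple a b c) q
        \<in> normed.metric.mball ((\<lambda>(a, b, c). module_triple a b c) p) \<epsilon>)"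
    using near by blast
qed

end

lemma (in hilbert_c_star_module) jb_star_triple_module_triple:
  "jb_star_triple scaleE (module_norm ip) module_triple"
proof -
  interpret complex_normed_space scaleE "module_norm ip"
    by (rule complex_normed_space)
  interpret complex_banach_space scaleE "module_norm ip"
    by unfold_locales (rule complete)
  have sym: "module_triple a b c = module_triple c b a" for a b c
    by (simp add: module_triple_def add.commute)
  have lin: "Vector_Spaces.linear scaleE scaleE (module_triple a b)"
    "Vector_Spaces.linear scaleE scaleE (\<lambda>a. module_triple a b c)" for a b c
    by (auto intro!: linearI simp: module_triple_add module_triple_scale)
  have bound: "module_norm ip (module_triple a a z) \<le> (module_norm ip a)\<^sup>2 * module_norm ip z" for a z
    using module_triple_bound[of a a z] by (simp add: power2_eq_square)
  show ?thesis
  proof unfold_locales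
    fix a b c d z b' :: 'e and \<alpha> :: complex
    show "hermitian_op (module_triple a a)"
      by (rule hermitian_op_if_imaginary_step[OF lin(1) bound _ module_triple_imaginary_step]) simp_all
    show "op_spectrum (module_triple a a) \<subseteq> \<real>\<^sub>\<ge>\<^sub>0"
      by (rule op_spectrum_nonneg[OF lin(1) module_triple_imaginary_step _
            module_triple_contraction[where t = "(module_norm ip a)\<^sup>2 + 1"]])
         (simp_all add: add_nonneg_pos)
  qed (fact module_triple_continuous sym lin module_triple_add module_triple_scale
      module_triple_jordan nrm_module_triple_diagonal)+
qed

theorem theorem0p2:
  fixes scaleA :: "complex \<Rightarrow> 'a \<Rightarrow> 'a::{real_normed_algebra,banach}"
    and star :: "'a \<Rightarrow> 'a"
    and scaleE :: "complex \<Rightarrow> 'e \<Rightarrow> 'e::ab_group_add"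
    and act :: "'e \<Rightarrow> 'a \<Rightarrow> 'e"
    and ip :: "'e \<Rightarrow> 'e \<Rightarrow> 'a"
  assumes "hilbert_c_star_module scaleA star scaleE act ip"
  shows "jb_star_triple scaleE (module_norm ip)
           (\<lambda>x y z. scaleE (1/2) (act x (ip y z) + act z (ip y x)))"
proof -
  interpret hilbert_c_star_module scaleA star scaleE act ip by (rule assms)
  show ?thesis
    using jb_star_triple_module_triple unfolding module_triple_def[abs_def] .
qed

end
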